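(* Let $m\in\mathbb{N}^*$, $a\in\mathbb{R}$, $I_f\in\mathbb{I}_{a+}$, let $f:\mathbb{R}^m\times I_f\to\mathbb{R}^m$ be a Carathéodory function, let $q_a\in\mathbb{R}^m$ and $\alpha=(\alpha_1,\dots,\alpha_m)\in(0,1]^m$. Assume that $f(q,\cdot)\in\mathrm{L}^1_{\mathrm{loc}}(I_f,\mathbb{R}^m)$ for any $q\in\mathrm{L}^1_{\mathrm{loc}}(I_f,\mathbb{R}^m)$. Then a function $q:I_f\to\mathbb{R}^m$ is a (global) solution of the Cauchy problem $$\mathrm{D}^\alpha_{a+}[q](t)=f(q(t),t),\qquad \mathrm{I}^{1-\alpha}_{a+}[q](a)=q_a$$ if and only if $q\in\mathrm{L}^1_{\mathrm{loc}}(I_f,\mathbb{R}^m)$ and $$q(t)=\mathrm{D}^{1-\alpha}_{a+}[q_a](t)+\mathrm{I}^\alpha_{a+}[f(q,\cdot)](t)=\Big[\tfrac{1}{\Gamma(\alpha)}(t-a)^{\alpha-1}\Big]\otimes q_a+\int_a^t\Big[\tfrac{1}{\Gamma(\alpha)}(t-\tau)^{\alpha-1}\Big]\otimes f(q(\tau),\tau)\,d\tau$$ for almost every $t\in I_f$.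
   Context: $\mathbb{N}^*$ is the set of positive integers. For $a\in\mathbb{R}$, $\mathbb{I}_{a+}$ denotes the set of intervals $I\subset\mathbb{R}$ with $\{a\}\subsetneq I\subset[a,+\infty)$ (not necessarily compact). $\mathrm{L}^1_{\mathrm{loc}}(I)$ (resp. $\mathrm{AC}_{\mathrm{loc}}(I)$) is the set of functions on $I$ that are integrable (resp. absolutely continuous) on every compact subinterval of $I$. The notation $f(q,\cdot)$ stands for the function $t\mapsto f(q(t),t)$. Left Riemann-Liouville operators. Let $I\in\mathbb{I}_{a+}$ and $q\in \mathrm{L}^1_{\mathrm{loc}}(I,\mathbb{R})$. For a real $\alpha>0$, $\mathrm{I}^\alpha_{a+}[q](t):=\int_a^t\frac{1}{\Gamma(\alpha)}(t-\tau)^{\alpha-1}q(\tau)\,d\tau$ (defined for a.e. $t\in I$), and $\mathrm{I}^0_{a+}[q]:=q$; if $\mathrm{I}^\alpha_{a+}[q]$ is a.e. equal to a continuous function, it is identified with it. For $0\le\alpha\le1$, $\mathrm{AC}^\alpha_{a+}(I,\mathbb{R})$ is the set of $q\in \mathrm{L}^1_{\mathrm{loc}}(I,\mathbb{R})$ with $\mathrm{I}^{1-\alpha}_{a+}[q]\in\mathrm{AC}_{\mathrm{loc}}(I,\mathbb{R})$, and then $\mathrm{D}^\alpha_{a+}[q]:=\frac{d}{dt}\mathrm{I}^{1-\alpha}_{a+}[q]$ a.e. on $I$. For vector functions $q=(q_i)$ and a multi-order $\alpha=(\alpha_i)$ everything is taken componentwise, the $i$-th component with order $\alpha_i$. In $\mathrm{D}^{1-\alpha}_{a+}[q_a]$,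 $q_a$ is viewed as a constant function. $\otimes$ is the componentwise (Hadamard) product and $\big[\frac{1}{\Gamma(\alpha)}(t-\tau)^{\alpha-1}\big]$ is the vector with components $\frac{1}{\Gamma(\alpha_i)}(t-\tau)^{\alpha_i-1}$. A (global) solution of the Cauchy problem is a function $q:I_f\to\mathbb{R}^m$ with $q\in\mathrm{AC}^\alpha_{a+}(I_f,\mathbb{R}^m)$, $\mathrm{I}^{1-\alpha}_{a+}[q](a)=q_a$, and $\mathrm{D}^\alpha_{a+}[q](t)=f(q(t),t)$ for almost every $t\in I_f$. *)

theory Defs
  imports "HOL-Analysis.Analysis"
begin

definition left_intervals :: "real \<Rightarrow> real set set" where
  "left_intervals a = {I. is_interval I \<and> {a} \<subset> I \<and> I \<subseteq> {a..}}"

text \<open>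
  A function on an interval \<open>I\<close> is represented by a total function of which only the values on
  \<open>I\<close> matter.
\<close>

definition L1_loc :: "real set \<Rightarrow> (real \<Rightarrow> 'a::euclidean_space) set" where
  "L1_loc I = {q. \<forall>c d. {c..d} \<subseteq> I \<longrightarrow> q absolutely_integrable_on {c..d}}"

text \<open>
  The usual \<open>\<epsilon>\<close>-\<open>\<delta>\<close> condition over finite families of non-overlapping compact subintervals;
  every member \<open>k\<close> of such a family \<open>D\<close> is \<open>{Inf k..Sup k}\<close>.
\<close>
definition AC_on :: "real set \<Rightarrow> (real \<Rightarrow> real) \<Rightarrow> bool" where
  "AC_on S F \<longleftrightarrow>
     (\<forall>\<epsilon>>0. \<exists>\<delta>>0. \<forall>D T. D division_of T \<and> T \<subseteq> S \<and> (\<Sum>k\<in>D. Sup k - Inf k) < \<delta> \<longrightarrow>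
        (\<Sum>k\<in>D. \<bar>F (Sup k) - F (Inf k)\<bar>) < \<epsilon>)"

definition AC_loc :: "real set \<Rightarrow> (real \<Rightarrow> real) set" where
  "AC_loc I = {F. \<forall>c d. {c..d} \<subseteq> I \<longrightarrow> AC_on {c..d} F}"

definition caratheodory :: "real set \<Rightarrow> ((real^'m) \<Rightarrow> real \<Rightarrow> (real^'m)) \<Rightarrow> bool" where
  "caratheodory I f \<longleftrightarrow>
     (\<forall>x. f x \<in> borel_measurable (lebesgue_on I)) \<and>
     (AE t in lebesgue_on I. continuous_on UNIV (\<lambda>x. f x t))"

definition RL_integral_raw :: "real \<Rightarrow> real \<Rightarrow> (real \<Rightarrow> real) \<Rightarrow> real \<Rightarrow> real" where
  "RL_integral_raw a \<alpha> q t =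
     (if \<alpha> = 0 then q t
      else LINT \<tau>:{a..t}|lebesgue. (1 / Gamma \<alpha> * (t - \<tau>) powr (\<alpha> - 1)) * q \<tau>)"

text \<open>
  A function that agrees almost everywhere on \<open>I\<close> with a continuous function is identified with
  it. On a nondegenerate interval \<open>I\<close> the continuous function is unique (as a function on \<open>I\<close>),
  so the choice is harmless. This gives a meaning to the value of the fractional integral at the
  single point \<open>a\<close>.
\<close>
definition cont_rep :: "real set \<Rightarrow> (real \<Rightarrow> real) \<Rightarrow> real \<Rightarrow> real" where
  "cont_rep I g =
     (if \<exists>F. continuous_on I F \<and> (AE t in lebesgue_on I. g t = F t)
      then SOME F. continuous_on I F \<and> (AE t in lebesgue_on I. g t = F t)
      else g)"

definition RL_integral :: "real \<Rightarrow> real set \<Rightarrow> real \<Rightarrow> (real \<Rightarrow> real) \<Rightarrow> real \<Rightarrow> real" where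
  "RL_integral a I \<alpha> q = cont_rep I (RL_integral_raw a \<alpha> q)"

definition AC_frac :: "real \<Rightarrow> real set \<Rightarrow> real \<Rightarrow> (real \<Rightarrow> real) set" where
  "AC_frac a I \<alpha> = {q \<in> L1_loc I. RL_integral a I (1 - \<alpha>) q \<in> AC_loc I}"

definition RL_deriv :: "real \<Rightarrow> real set \<Rightarrow> real \<Rightarrow> (real \<Rightarrow> real) \<Rightarrow> real \<Rightarrow> real" where
  "RL_deriv a I \<alpha> q t = deriv (RL_integral a I (1 - \<alpha>) q) t"

definition RL_integral_vec ::
  "real \<Rightarrow> real set \<Rightarrow> real^'m \<Rightarrow> (real \<Rightarrow> real^'m) \<Rightarrow> real \<Rightarrow> real^'m" where
  "RL_integral_vec a I \<alpha> q t = (\<chi> i. RL_integral a I (\<alpha> $ i) (\<lambda>s. q s $ i) t)"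

definition AC_frac_vec :: "real \<Rightarrow> real set \<Rightarrow> real^'m \<Rightarrow> (real \<Rightarrow> real^'m) set" where
  "AC_frac_vec a I \<alpha> = {q. \<forall>i. (\<lambda>s. q s $ i) \<in> AC_frac a I (\<alpha> $ i)}"

definition RL_deriv_vec ::
  "real \<Rightarrow> real set \<Rightarrow> real^'m \<Rightarrow> (real \<Rightarrow> real^'m) \<Rightarrow> real \<Rightarrow> real^'m" where
  "RL_deriv_vec a I \<alpha> q t = (\<chi> i. RL_deriv a I (\<alpha> $ i) (\<lambda>s. q s $ i) t)"

definition RL_kernel :: "real^'m \<Rightarrow> real \<Rightarrow> real^'m" where
  "RL_kernel \<alpha> s = (\<chi> i. 1 / Gamma (\<alpha> $ i) * s powr (\<alpha> $ i - 1))"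

text \<open>In \<open>1 - \<alpha>\<close> the unit of \<^typ>\<open>real^'m\<close> is the vector all of whose components are 1.\<close>
definition RL_solution ::
  "real \<Rightarrow> real set \<Rightarrow> ((real^'m) \<Rightarrow> real \<Rightarrow> (real^'m)) \<Rightarrow> real^'m \<Rightarrow> real^'m \<Rightarrow> (real \<Rightarrow> real^'m) \<Rightarrow> bool"
where
  "RL_solution a I f \<alpha> q\<^sub>a q \<longleftrightarrow>
     q \<in> AC_frac_vec a I \<alpha> \<and>
     RL_integral_vec a I (1 - \<alpha>) q a = q\<^sub>a \<and>
     (AE t in lebesgue_on I. RL_deriv_vec a I \<alpha> q t = f (q t) t)"

end

theory Submission
  imports Defs
begin

text \<open>
  Write \<open>J\<^sup>\<alpha>\<close> for the fractional integral and \<open>g = f(q, \<cdot>)\<close>. A locally absolutely continuous function is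
  the primitive of its derivative, and conversely a primitive of a locally integrable \<open>g\<close> has
  derivative \<open>g\<close> almost everywhere; so the Cauchy problem says precisely that
  \<open>J\<^sup>1\<^sup>-\<^sup>\<alpha> q = q\<^sub>a + J\<^sup>1 g\<close> almost everywhere. Applying \<open>J\<^sup>\<alpha>\<close> and using the semigroup law
  (Fubini and the Beta integral) turns this into
  \<open>J\<^sup>1 q = J\<^sup>1 (D\<^sup>1\<^sup>-\<^sup>\<alpha> q\<^sub>a + J\<^sup>\<alpha> g)\<close> everywhere, hence into the Volterra equation by
  differentiation; applying \<open>J\<^sup>1\<^sup>-\<^sup>\<alpha>\<close> to the Volterra equation leads back.

  The fact that an absolutely continuous \<open>F\<close> is a primitive is reduced to the monotone case by
  subtracting from the positive variation of \<open>F\<close>; for monotone \<open>F\<close> the Stieltjes measure is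
  absolutely continuous and its Radon-Nikodym density is the required integrand.
\<close>

section \<open>Lebesgue differentiation of primitives\<close>

text \<open>Once \<open>q\<close> is fixed, \<open>f\<close> enters only through the fixed locally
  integrable function \<open>g\<close>, so the equivalence is linear and can be treated one
  component at a time. The obstacle is that \<open>q\<close> is merely integrable: its integral of
  order 1 - \<alpha> is known only almost everywhere, and its value at \<open>a\<close> has a
  meaning only through the continuous representative. Composition to a total order of at least 1
  removes the difficulty: there the kernel is bounded on bounded sets, so primitives can be compared
  at every point and then differentiated. The case \<alpha> = 1 stands apart, because an integral of
  order 0 is \<open>q\<close> itself and not a convolution. Convolutions are formed for Borel
  functions supported in one compact \<open>{a..b}\<close>, since Fubini's theorem is applied to the
  product of \<open>lborel\<close> with itself; the results are patched together afterwards, as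
  \<open>I\<close> may be unbounded or lack its right endpoint.\<close>

lemma AE_lebesgue_on_iff_negligible:
  assumes "S \<in> sets lebesgue"
  shows "(AE x in lebesgue_on S. P x) \<longleftrightarrow> negligible {x \<in> S. \<not> P x}"
proof -
  have "(AE x in lebesgue_on S. P x) \<longleftrightarrow> (AE x in lebesgue. x \<in> S \<longrightarrow> P x)"
    using assms by (simp add: AE_restrict_space_iff)
  also have "\<dots> \<longleftrightarrow> {x. \<not> (x \<in> S \<longrightarrow> P x)} \<in> null_sets lebesgue"
    by (simp add: completion.AE_iff_null_sets)
  also have "{x. \<not> (x \<in> S \<longrightarrow> P x)} = {x \<in> S. \<not> P x}" by auto
  finally show ?thesis by (simp add: negligible_iff_null_sets)
qed

text \<open>
  By Henstock's lemma, disjoint short intervals anchored at points where the difference quotient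
  is off by \<open>e\<close> have small total length; by Vitali's covering lemma five-fold enlargements of the
  corresponding balls cover all such points.
\<close>
lemma negligible_not_has_derivative_integral:
  fixes g :: "real \<Rightarrow> real"
  assumes g: "g integrable_on {a..b}"
  shows "negligible {t \<in> {a<..<b}. \<not> ((\<lambda>x. integral {a..x} g) has_real_derivative g t) (at t)}"
proof -
  define G where "G x = integral {a..x} g" for x
  define B where "B e = {t \<in> {a<..<b}. \<forall>d>0. \<exists>s\<in>{a<..<b}. s \<noteq> t \<and> \<bar>s - t\<bar> < d \<and>
      e * \<bar>s - t\<bar> \<le> \<bar>G s - G t - g t * (s - t)\<bar>}" for e :: real
  have neg: "negligible (B e)" if e: "e > 0" for e
    unfolding negligible_outer_le
  proof (intro allI impI)
    fix \<epsilon> :: real assume \<epsilon>: "\<epsilon> > 0"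
    \<comment> \<open>This bound on the Henstock sum bounds the sum of the radii by \<epsilon> / 10,
      and a ball enlarged five times has length ten times its original radius.\<close>
    have "e * \<epsilon> / 10 > 0" using e \<epsilon> by simp
    then obtain \<gamma> where \<gamma>: "gauge \<gamma>"
      and hen: "\<And>p. \<lbrakk>p tagged_partial_division_of (cbox a b); \<gamma> fine p\<rbrakk> \<Longrightarrow>
             sum (\<lambda>(x,k). norm(measure lborel k *\<^sub>R g x - integral k g)) p < e * \<epsilon> / 10"
      using Henstock_lemma[of g a b "e * \<epsilon> / 10"] g unfolding box_real by blast
    \<comment> \<open>The partner \<open>s\<close> is so close to \<open>t\<close> that the whole
      ball lies in \<open>\<gamma> t\<close> (fineness) and in the interval; Vitali's lemma asks for
      the bound 1 on the radii.\<close>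
    have "\<forall>t\<in>B e. \<exists>s. s \<in> {a<..<b} \<and> s \<noteq> t \<and> \<bar>s - t\<bar> \<le> 1 \<and> cball t \<bar>s - t\<bar> \<subseteq> \<gamma> t
        \<and> cball t \<bar>s - t\<bar> \<subseteq> {a<..<b} \<and> e * \<bar>s - t\<bar> \<le> \<bar>G s - G t - g t * (s - t)\<bar>"
    proof
      fix t assume t: "t \<in> B e"
      have "open (\<gamma> t \<inter> {a<..<b})" "t \<in> \<gamma> t \<inter> {a<..<b}"
        using \<gamma> t by (auto simp: gauge_def B_def)
      then obtain d where d: "d > 0" "cball t d \<subseteq> \<gamma> t \<inter> {a<..<b}"
        using open_contains_cball by blast
      have "min d 1 > 0" using d by simp
      with t obtain s where s: "s\<in>{a<..<b}" "s \<noteq> t" "\<bar>s - t\<bar> < min d 1"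
        "e * \<bar>s - t\<bar> \<le> \<bar>G s - G t - g t * (s - t)\<bar>"
        unfolding B_def by blast
      then have "cball t \<bar>s - t\<bar> \<subseteq> cball t d" by (intro cball_subset_cball_iff[THEN iffD2]) auto
      with s d show "\<exists>s. s \<in> {a<..<b} \<and> s \<noteq> t \<and> \<bar>s - t\<bar> \<le> 1 \<and> cball t \<bar>s - t\<bar> \<subseteq> \<gamma> t
        \<and> cball t \<bar>s - t\<bar> \<subseteq> {a<..<b} \<and> e * \<bar>s - t\<bar> \<le> \<bar>G s - G t - g t * (s - t)\<bar>"
        by (intro exI[of _ s]) auto
    qed
    then obtain s where s: "\<And>t. t \<in> B e \<Longrightarrow> s t \<in> {a<..<b} \<and> s t \<noteq> t \<and> \<bar>s t - t\<bar> \<le> 1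
        \<and> cball t \<bar>s t - t\<bar> \<subseteq> \<gamma> t \<and> cball t \<bar>s t - t\<bar> \<subseteq> {a<..<b}
        \<and> e * \<bar>s t - t\<bar> \<le> \<bar>G (s t) - G t - g t * (s t - t)\<bar>"
      by metis
    define r where "r t = \<bar>s t - t\<bar>" for t
    obtain C where C: "countable C" "C \<subseteq> B e"
      "pairwise (\<lambda>i j. disjnt (cball i (r i)) (cball j (r j))) C"
      "B e \<subseteq> (\<Union>i\<in>C. cball i (5 * r i))"
    proof (rule Vitali_covering_lemma_cballs[where S="B e" and K="B e" and a="\<lambda>t. t" and r=r and B=1])
      show "B e \<subseteq> (\<Union>i\<in>B e. cball i (r i))" using s by (force simp: r_def)
    qed (use s in \<open>auto simp: r_def\<close>)
    \<comment> \<open>\<open>t\<close> is an endpoint of \<open>J t\<close>, so the Henstock summand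
      tagged at \<open>t\<close> is exactly the defect in the definition of \<open>B e\<close>. As
      \<open>J t\<close> lies in its ball, disjoint balls give a partial division.\<close>
    define J where "J t = {min t (s t)..max t (s t)}" for t
    have fin: "(\<Sum>t\<in>X. 10 * r t) \<le> \<epsilon>" if X: "X \<subseteq> C" "finite X" for X
    proof -
      have JX: "t \<in> J t" "J t \<subseteq> cball t (r t)" "J t \<subseteq> {a..b}" "J t \<subseteq> \<gamma> t" if "t \<in> X" for t
      proof -
        have tB: "t \<in> B e" using that X C by auto
        show "t \<in> J t" "J t \<subseteq> cball t (r t)" by (auto simp: J_def r_def dist_real_def)
        with s[OF tB] show "J t \<subseteq> {a..b}" "J t \<subseteq> \<gamma> t" unfolding r_def by force+
      qed
      let ?p = "(\<lambda>t. (t, J t)) ` X"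
      have disj: "interior (J t) \<inter> interior (J u) = {}" if "t \<in> X" "u \<in> X" "t \<noteq> u" for t u
      proof -
        have "cball t (r t) \<inter> cball u (r u) = {}"
          using C(3) that X unfolding pairwise_def disjnt_def by blast
        then show ?thesis using JX that interior_subset by blast
      qed
      have "?p tagged_partial_division_of cbox a b"
        unfolding tagged_partial_division_of_def
      proof (intro conjI allI impI)
        show "finite ?p" using X by simp
        fix x K assume "(x, K) \<in> ?p"
        then have xK: "x \<in> X" "K = J x" by auto
        show "x \<in> K" "K \<subseteq> cbox a b"
          using JX[OF xK(1)] xK(2) by (simp_all only: box_real)
        show "\<exists>a b. K = cbox a b"
          unfolding xK(2) J_def box_real by blast
      next
        show "interior K1 \<inter> interior K2 = {}"
          if "(x1, K1) \<in> ?p \<and> (x2, K2) \<in> ?p \<and> (x1, K1) \<noteq> (x2, K2)" for x1 K1 x2 K2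
          using that disj[of x1 x2] by auto
      qed
      moreover have "\<gamma> fine ?p" using JX by (auto simp: fine_def)
      ultimately have "(\<Sum>(x,k)\<in>?p. norm(measure lborel k *\<^sub>R g x - integral k g)) < e * \<epsilon> / 10"
        by (rule hen)
      moreover have "(\<Sum>(x,k)\<in>?p. norm(measure lborel k *\<^sub>R g x - integral k g))
           = (\<Sum>t\<in>X. norm (measure lborel (J t) *\<^sub>R g t - integral (J t) g))"
        by (subst sum.reindex) (auto simp: inj_on_def)
      moreover have "e * r t \<le> norm (measure lborel (J t) *\<^sub>R g t - integral (J t) g)" if t: "t \<in> X" for t
      proof -
        have tB: "t \<in> B e" using t X C by auto
        then have ab: "a < t" "t < b" "a < s t" "s t < b" using s[OF tB] by (auto simp: B_def)
        have sub: "g integrable_on {a..x}" if "x \<le> b" for x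
          using integrable_on_subinterval[OF g] that by auto
        have GG: "G y = G x + integral {x..y} g" if "a \<le> x" "x \<le> y" "y \<le> b" for x y
          unfolding G_def using Henstock_Kurzweil_Integration.integral_combine[of a x y g] that sub by auto
        have "integral (J t) g = (if t \<le> s t then G (s t) - G t else G t - G (s t))"
          using ab GG[of t "s t"] GG[of "s t" t] by (auto simp: J_def min_def max_def)
        moreover have "measure lborel (J t) = \<bar>s t - t\<bar>"
          by (auto simp: J_def)
        ultimately show ?thesis using s[OF tB] unfolding r_def
          by (auto simp: abs_if algebra_simps split: if_splits)
      qed
      ultimately have "(\<Sum>t\<in>X. e * r t) < e * \<epsilon> / 10"
        by (smt (verit, best) sum_mono)
      then have "e * (10 * sum r X) < e * \<epsilon>" by (simp add: sum_distrib_left[symmetric])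
      then show ?thesis using e by (simp add: sum_distrib_left[symmetric])
    qed
    let ?T = "\<Union>i\<in>C. cball i (5 * r i)"
    have r0: "0 \<le> r t" for t by (simp add: r_def)
    have "measure lebesgue (\<Union>i\<in>X. cball i (5 * r i)) \<le> \<epsilon>" if X: "X \<subseteq> C" "finite X" for X
    proof -
      have "measure lebesgue (\<Union>i\<in>X. cball i (5 * r i)) \<le> (\<Sum>i\<in>X. measure lebesgue (cball i (5 * r i)))"
        by (rule measure_UNION_le) (use X in auto)
      also have "\<dots> = (\<Sum>t\<in>X. 10 * r t)"
        using r0 by (intro sum.cong) (auto simp: cball_eq_atLeastAtMost)
      finally show ?thesis using fin[OF X] by linarith
    qed
    then have "?T \<in> lmeasurable \<and> measure lebesgue ?T \<le> \<epsilon>"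
      by (intro conjI fmeasurable_UN_bound[OF C(1)] measure_UN_bound[OF C(1)]) auto
    with C show "\<exists>T. B e \<subseteq> T \<and> T \<in> lmeasurable \<and> measure lebesgue T \<le> \<epsilon>" by blast
  qed
  have "negligible (\<Union>n::nat. B (1 / Suc n))"
    by (rule negligible_countable_Union) (auto intro!: neg)
  moreover have "{t \<in> {a<..<b}. \<not> (G has_real_derivative g t) (at t)} \<subseteq> (\<Union>n::nat. B (1 / Suc n))"
  proof clarsimp
    fix t assume t: "a < t" "t < b" "\<not> (G has_real_derivative g t) (at t)"
    show "\<exists>n. t \<in> B (1 / (1 + real n))"
    proof (rule ccontr)
      assume n: "\<nexists>n. t \<in> B (1 / (1 + real n))"
      have "(G has_derivative (*) (g t)) (at t)"
        unfolding has_derivative_at_alt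
      proof (intro conjI allI impI bounded_linear_mult_right)
        fix e :: real assume "e > 0"
        then obtain n where n': "1 / (1 + real n) < e" using nat_approx_posE by (metis of_nat_Suc add.commute)
        have "t \<notin> B (1 / (1 + real n))" using n by blast
        with t have "\<exists>d>0. \<not> (\<exists>s\<in>{a<..<b}. s \<noteq> t \<and> \<bar>s - t\<bar> < d \<and>
            1 / (1 + real n) * \<bar>s - t\<bar> \<le> \<bar>G s - G t - g t * (s - t)\<bar>)"
          unfolding B_def by simp
        then obtain d where d: "d > 0" "\<And>s. s\<in>{a<..<b} \<Longrightarrow> s \<noteq> t \<Longrightarrow> \<bar>s - t\<bar> < d \<Longrightarrow>
           \<bar>G s - G t - g t * (s - t)\<bar> < 1 / (1 + real n) * \<bar>s - t\<bar>"
          by (meson not_le)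
        show "\<exists>d>0. \<forall>y. norm (y - t) < d \<longrightarrow> norm (G y - G t - g t * (y - t)) \<le> e * norm (y - t)"
        proof (intro exI[of _ "min d (min (t - a) (b - t))"] conjI allI impI)
          show "0 < min d (min (t - a) (b - t))" using d t by auto
          fix y assume y: "norm (y - t) < min d (min (t - a) (b - t))"
          show "norm (G y - G t - g t * (y - t)) \<le> e * norm (y - t)"
          proof (cases "y = t")
            case False
            then have "\<bar>G y - G t - g t * (y - t)\<bar> < 1 / (1 + real n) * \<bar>y - t\<bar>" using y by (intro d) auto
            also have "\<dots> \<le> e * \<bar>y - t\<bar>" using n' by (intro mult_right_mono) auto
            finally show ?thesis by simp
          qed auto
        qed
      qed
      with t show False by (auto simp: has_field_derivative_def)
    qed
  qed
  ultimately show ?thesis unfolding G_def using negligible_subset by blast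
qed

section \<open>Absolutely continuous functions are primitives\<close>

text \<open>
  Indexed families instead of sets of intervals: cutting at a point just clamps both endpoint
  functions, and distinct indices that become equal (degenerate) intervals do no harm.
\<close>
definition interval_family :: "'i set \<Rightarrow> ('i \<Rightarrow> real) \<Rightarrow> ('i \<Rightarrow> real) \<Rightarrow> real \<Rightarrow> real \<Rightarrow> bool" where
  "interval_family A l r s t \<longleftrightarrow> finite A \<and> (\<forall>i\<in>A. s \<le> l i \<and> l i \<le> r i \<and> r i \<le> t) \<and>
     (\<forall>i\<in>A. \<forall>j\<in>A. i \<noteq> j \<longrightarrow> {l i<..<r i} \<inter> {l j<..<r j} = {})"

lemma interval_family_empty [simp]: "interval_family {} l r s t"
  by (simp add: interval_family_def)

lemma interval_family_mono:
  "interval_family A l r s t \<Longrightarrow> s' \<le> s \<Longrightarrow> t \<le> t' \<Longrightarrow> interval_family A l r s' t'"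
  unfolding interval_family_def by force

lemma interval_family_length:
  assumes fam: "interval_family A l r s t" and "s \<le> t"
  shows "(\<Sum>i\<in>A. r i - l i) \<le> t - s"
proof -
  have fin: "finite A" using fam by (simp add: interval_family_def)
  have "(\<Sum>i\<in>A. r i - l i) = (\<Sum>i\<in>A. measure lebesgue {l i<..<r i})"
    using fam by (intro sum.cong) (auto simp: interval_family_def)
  also have "\<dots> = measure lebesgue (\<Union>i\<in>A. {l i<..<r i})"
    using fam by (intro measure_finite_Union[symmetric] fin)
      (auto simp: interval_family_def disjoint_family_on_def)
  also have "\<dots> \<le> measure lebesgue {s..t}"
  proof (rule measure_mono_fmeasurable)
    show "(\<Union>i\<in>A. {l i<..<r i}) \<subseteq> {s..t}"
      using fam unfolding interval_family_def by fastforce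
  qed (use fin in auto)
  finally show ?thesis using \<open>s \<le> t\<close> by simp
qed

lemma interval_family_split:
  assumes fam: "interval_family A l r s u" and t: "s \<le> t" "t \<le> u"
  shows "interval_family A (\<lambda>i. min t (l i)) (\<lambda>i. min t (r i)) s t"
    and "interval_family A (\<lambda>i. max t (l i)) (\<lambda>i. max t (r i)) t u"
    and "(\<Sum>i\<in>A. F (r i) - F (l i)) =
       (\<Sum>i\<in>A. F (min t (r i)) - F (min t (l i))) + (\<Sum>i\<in>A. F (max t (r i)) - F (max t (l i)) :: real)"
proof -
  have sub: "{min t (l i)<..<min t (r i)} \<subseteq> {l i<..<r i}" "{max t (l i)<..<max t (r i)} \<subseteq> {l i<..<r i}" for i
    by auto
  have fin: "finite A" and lr: "\<And>i. i \<in> A \<Longrightarrow> s \<le> l i \<and> l i \<le> r i \<and> r i \<le> u"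
    and disj: "\<And>i j. i \<in> A \<Longrightarrow> j \<in> A \<Longrightarrow> i \<noteq> j \<Longrightarrow> {l i<..<r i} \<inter> {l j<..<r j} = {}"
    using fam unfolding interval_family_def by blast+
  show "interval_family A (\<lambda>i. min t (l i)) (\<lambda>i. min t (r i)) s t"
    unfolding interval_family_def
  proof (intro conjI ballI impI fin)
    fix i j assume "i \<in> A" "j \<in> A" "i \<noteq> j"
    from disj[OF this] show "{min t (l i)<..<min t (r i)} \<inter> {min t (l j)<..<min t (r j)} = {}"
      using sub(1)[of i] sub(1)[of j] by blast
  qed (use lr t in force)+
  show "interval_family A (\<lambda>i. max t (l i)) (\<lambda>i. max t (r i)) t u"
    unfolding interval_family_def
  proof (intro conjI ballI impI fin)
    fix i j assume "i \<in> A" "j \<in> A" "i \<noteq> j"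
    from disj[OF this] show "{max t (l i)<..<max t (r i)} \<inter> {max t (l j)<..<max t (r j)} = {}"
      using sub(2)[of i] sub(2)[of j] by blast
  qed (use lr t in force)+
  have "F (min t x) + F (max t x) = F x + F t" for x by (auto simp: min_def max_def)
  then have "F (r i) - F (l i) = (F (min t (r i)) - F (min t (l i))) + (F (max t (r i)) - F (max t (l i)))" for i
    by (smt (verit))
  then show "(\<Sum>i\<in>A. F (r i) - F (l i)) =
       (\<Sum>i\<in>A. F (min t (r i)) - F (min t (l i))) + (\<Sum>i\<in>A. F (max t (r i)) - F (max t (l i)))"
    by (simp add: sum.distrib)
qed

text \<open>Degenerate intervals are dropped: among the others, distinct indices have disjoint
  nonempty open intervals, so the map from indices to intervals is injective and its image is a
  division. The dropped ones contribute 0 to both sums and can be put back.\<close>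

lemma AC_on_family:
  fixes F :: "real \<Rightarrow> real"
  assumes \<delta>: "\<forall>D T. D division_of T \<and> T \<subseteq> {a..b} \<and> (\<Sum>k\<in>D. Sup k - Inf k) < \<delta> \<longrightarrow>
        (\<Sum>k\<in>D. \<bar>F (Sup k) - F (Inf k)\<bar>) < \<epsilon>"
    and fam: "interval_family A l r a b" and len: "(\<Sum>i\<in>A. r i - l i) < \<delta>"
  shows "(\<Sum>i\<in>A. \<bar>F (r i) - F (l i)\<bar>) < \<epsilon>"
proof -
  let ?A = "{i\<in>A. l i < r i}"
  let ?k = "\<lambda>i. {l i..r i}"
  have fin: "finite A" using fam by (simp add: interval_family_def)
  have disj: "{l i<..<r i} \<inter> {l j<..<r j} = {}" if "i \<in> A" "j \<in> A" "i \<noteq> j" for i j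
    using fam that by (auto simp: interval_family_def)
  have inj: "inj_on ?k ?A"
  proof (rule inj_onI)
    fix i j assume ij: "i \<in> ?A" "j \<in> ?A" "?k i = ?k j"
    then have "l i = l j" "r i = r j" by auto
    with ij disj[of i j] show "i = j" by auto
  qed
  have div: "(?k ` ?A) division_of (\<Union>(?k ` ?A))"
  proof (rule division_ofI)
    fix K1 K2 assume "K1 \<in> ?k ` ?A" "K2 \<in> ?k ` ?A" "K1 \<noteq> K2"
    then obtain i j where "i \<in> A" "j \<in> A" "K1 = ?k i" "K2 = ?k j" "i \<noteq> j" by auto
    then show "interior K1 \<inter> interior K2 = {}" using disj by simp
  next
    fix K assume "K \<in> ?k ` ?A"
    then show "\<exists>a b. K = cbox a b" by (metis (no_types, lifting) box_real(2) imageE)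
  qed (use fin in auto)
  have eq: "(\<Sum>k\<in>?k ` ?A. G (Inf k) (Sup k)) = (\<Sum>i\<in>A. G (l i) (r i))"
    if "\<And>x. G x x = 0" for G :: "real \<Rightarrow> real \<Rightarrow> real"
  proof -
    have "(\<Sum>k\<in>?k ` ?A. G (Inf k) (Sup k)) = (\<Sum>i\<in>?A. G (l i) (r i))"
      by (subst sum.reindex[OF inj]) (auto intro!: sum.cong)
    also have "\<dots> = (\<Sum>i\<in>A. G (l i) (r i))"
      using fam that by (intro sum.mono_neutral_left) (auto simp: interval_family_def order_less_le)
    finally show ?thesis .
  qed
  have "\<Union>(?k ` ?A) \<subseteq> {a..b}"
    using fam unfolding interval_family_def by fastforce
  moreover have "(\<Sum>k\<in>?k ` ?A. Sup k - Inf k) < \<delta>"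
    using eq[of "\<lambda>x y. y - x"] len by simp
  ultimately have "(\<Sum>k\<in>?k ` ?A. \<bar>F (Sup k) - F (Inf k)\<bar>) < \<epsilon>"
    using \<delta> div by blast
  then show ?thesis using eq[of "\<lambda>x y. \<bar>F y - F x\<bar>"] by simp
qed

text \<open>The index type is left open because the families used later are indexed by a single
  point, by numbers, by sets of reals and by pairs of a set and a number.\<close>

lemma AC_onE:
  assumes "AC_on {a..b} F" "\<epsilon> > 0"
  obtains \<delta> where "\<delta> > 0" "\<And>(A::'i set) l r. interval_family A l r a b \<Longrightarrow> (\<Sum>i\<in>A. r i - l i) < \<delta> \<Longrightarrow>
     (\<Sum>i\<in>A. \<bar>F (r i) - F (l i)\<bar>) < \<epsilon>"
proof -
  obtain \<delta> where "\<delta> > 0" and \<delta>: "\<forall>D T. D division_of T \<and> T \<subseteq> {a..b} \<and> (\<Sum>k\<in>D. Sup k - Inf k) < \<delta> \<longrightarrow>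
        (\<Sum>k\<in>D. \<bar>F (Sup k) - F (Inf k)\<bar>) < \<epsilon>"
    using assms unfolding AC_on_def by blast
  show thesis by (rule that[OF \<open>\<delta> > 0\<close> AC_on_family[OF \<delta>]])
qed

lemma division_interval_family:
  assumes D: "D division_of T" "T \<subseteq> {a..b}"
  shows "interval_family D Inf Sup a b"
    and "\<And>k. k \<in> D \<Longrightarrow> k = {Inf k..Sup k} \<and> Inf k \<le> Sup k"
proof -
  show k: "k = {Inf k..Sup k} \<and> Inf k \<le> Sup k" if kD: "k \<in> D" for k :: "real set"
  proof -
    obtain c d where "k = {c..d}" "k \<noteq> {}" using division_ofD(3)[OF D(1) kD] division_ofD(4)[OF D(1) kD] by (metis box_real(2))
    then show ?thesis by auto
  qed
  show "interval_family D Inf Sup a b"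
    unfolding interval_family_def
  proof (intro conjI ballI impI)
    show "finite D" using D by auto
    fix k assume "k \<in> D"
    moreover from this have "k \<subseteq> {a..b}" using D by blast
    ultimately show "a \<le> Inf k" "Inf k \<le> Sup k" "Sup k \<le> b"
      using k[of k] by (metis atLeastatMost_subset_iff)+
  next
    fix i j assume ij: "i \<in> D" "j \<in> D" "i \<noteq> j"
    then have "interior i \<inter> interior j = {}" using D by auto
    then show "{Inf i<..<Sup i} \<inter> {Inf j<..<Sup j} = {}"
      using k[OF ij(1)] k[OF ij(2)] by (metis interior_atLeastAtMost_real)
  qed
qed

lemma AC_on_subset: "AC_on S F \<Longrightarrow> T \<subseteq> S \<Longrightarrow> AC_on T F"
  unfolding AC_on_def by (meson order_trans)

text \<open>Families indexed by sets of reals suffice, since a division indexes itself through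
  \<open>Inf\<close> and \<open>Sup\<close>.\<close>

lemma AC_onI:
  assumes "\<And>\<epsilon>. \<epsilon> > 0 \<Longrightarrow> \<exists>\<delta>>0. \<forall>(A::real set set) l r. interval_family A l r a b \<longrightarrow>
     (\<Sum>i\<in>A. r i - l i) < \<delta> \<longrightarrow> (\<Sum>i\<in>A. \<bar>F (r i) - F (l i)\<bar>) < \<epsilon>"
  shows "AC_on {a..b} F"
  unfolding AC_on_def
proof (intro allI impI)
  fix \<epsilon> :: real assume "\<epsilon> > 0"
  then obtain \<delta> where "\<delta> > 0" "\<And>(A::real set set) l r. interval_family A l r a b \<Longrightarrow>
     (\<Sum>i\<in>A. r i - l i) < \<delta> \<Longrightarrow> (\<Sum>i\<in>A. \<bar>F (r i) - F (l i)\<bar>) < \<epsilon>"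
    using assms by blast
  then show "\<exists>\<delta>>0. \<forall>D T. D division_of T \<and> T \<subseteq> {a..b} \<and> (\<Sum>k\<in>D. Sup k - Inf k) < \<delta> \<longrightarrow>
        (\<Sum>k\<in>D. \<bar>F (Sup k) - F (Inf k)\<bar>) < \<epsilon>"
    using division_interval_family(1) by blast
qed

lemma AC_on_diff:
  assumes F: "AC_on {a..b} F" and G: "AC_on {a..b} G"
  shows "AC_on {a..b} (\<lambda>x. F x - G x)"
proof (rule AC_onI)
  fix \<epsilon> :: real assume "\<epsilon> > 0"
  then have e: "\<epsilon> / 2 > 0" by simp
  obtain d1 where d1: "d1 > 0" "\<And>(A::real set set) l r. interval_family A l r a b \<Longrightarrow> (\<Sum>i\<in>A. r i - l i) < d1 \<Longrightarrow>
     (\<Sum>i\<in>A. \<bar>F (r i) - F (l i)\<bar>) < \<epsilon> / 2" using AC_onE[OF F e] by blast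
  obtain d2 where d2: "d2 > 0" "\<And>(A::real set set) l r. interval_family A l r a b \<Longrightarrow> (\<Sum>i\<in>A. r i - l i) < d2 \<Longrightarrow>
     (\<Sum>i\<in>A. \<bar>G (r i) - G (l i)\<bar>) < \<epsilon> / 2" using AC_onE[OF G e] by blast
  show "\<exists>\<delta>>0. \<forall>(A::real set set) l r. interval_family A l r a b \<longrightarrow>
     (\<Sum>i\<in>A. r i - l i) < \<delta> \<longrightarrow> (\<Sum>i\<in>A. \<bar>(F (r i) - G (r i)) - (F (l i) - G (l i))\<bar>) < \<epsilon>"
  proof (intro exI[of _ "min d1 d2"] conjI allI impI)
    show "min d1 d2 > 0" using d1 d2 by simp
    fix A :: "real set set" and l r assume A: "interval_family A l r a b" "(\<Sum>i\<in>A. r i - l i) < min d1 d2"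
    have "(\<Sum>i\<in>A. \<bar>(F (r i) - G (r i)) - (F (l i) - G (l i))\<bar>)
       \<le> (\<Sum>i\<in>A. \<bar>F (r i) - F (l i)\<bar> + \<bar>G (r i) - G (l i)\<bar>)"
      by (intro sum_mono) linarith
    also have "\<dots> < \<epsilon>" using d1(2)[OF A(1)] d2(2)[OF A(1)] A(2) by (simp add: sum.distrib)
    finally show "(\<Sum>i\<in>A. \<bar>(F (r i) - G (r i)) - (F (l i) - G (l i))\<bar>) < \<epsilon>" .
  qed
qed

lemma AC_on_imp_continuous_on:
  assumes "AC_on {a..b} F"
  shows "continuous_on {a..b} F"
  unfolding continuous_on_iff
proof (intro ballI allI impI)
  fix x \<epsilon> :: real assume x: "x \<in> {a..b}" and "\<epsilon> > 0"
  obtain d where d: "d > 0" "\<And>(A::unit set) l r. interval_family A l r a b \<Longrightarrow> (\<Sum>i\<in>A. r i - l i) < d \<Longrightarrow>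
     (\<Sum>i\<in>A. \<bar>F (r i) - F (l i)\<bar>) < \<epsilon>" using AC_onE[OF assms \<open>\<epsilon> > 0\<close>] by blast
  show "\<exists>d>0. \<forall>y\<in>{a..b}. dist y x < d \<longrightarrow> dist (F y) (F x) < \<epsilon>"
  proof (intro exI[of _ d] conjI ballI impI)
    fix y assume y: "y \<in> {a..b}" "dist y x < d"
    have "interval_family {()} (\<lambda>_. min x y) (\<lambda>_. max x y) a b"
      using x y by (auto simp: interval_family_def)
    from d(2)[OF this] y show "dist (F y) (F x) < \<epsilon>"
      by (cases "x \<le> y") (auto simp: dist_real_def)
  qed fact
qed

section \<open>Positive variation of an absolutely continuous function\<close>

text \<open>
  The families need not cover \<open>{s..t}\<close>, so intervals on which \<open>F\<close> decreases are simply left out;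
  the index type \<^typ>\<open>nat\<close> is immaterial.
\<close>
definition positive_variation :: "(real \<Rightarrow> real) \<Rightarrow> real \<Rightarrow> real \<Rightarrow> real" where
  "positive_variation F s t =
     Sup {\<Sum>i\<in>A. F (r i) - F (l i) | (A::nat set) l r. interval_family A l r s t}"

text \<open>With \<open>d\<close> belonging to the tolerance 1, each stretch of length at most
  \<open>d / 2\<close> contributes less than 1, and finitely many stretches cover
  \<open>{a..b}\<close>.\<close>

lemma positive_variation_bounded:
  assumes "AC_on {a..b} F"
  shows "\<exists>B. \<forall>(A::nat set) l r. interval_family A l r a b \<longrightarrow> (\<Sum>i\<in>A. F (r i) - F (l i)) \<le> B"
proof (cases "a \<le> b")
  case False
  then have "A = {}" if "interval_family A l r a b" for A :: "nat set" and l r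
    using that unfolding interval_family_def by force
  then have "(\<Sum>i\<in>A. F (r i) - F (l i)) \<le> 0" if "interval_family A l r a b" for A :: "nat set" and l r
    using that sum.empty by (metis order_refl)
  then show ?thesis by blast
next
  case True
  obtain d where d: "d > 0" "\<And>(A::nat set) l r. interval_family A l r a b \<Longrightarrow> (\<Sum>i\<in>A. r i - l i) < d \<Longrightarrow>
     (\<Sum>i\<in>A. \<bar>F (r i) - F (l i)\<bar>) < 1" using AC_onE[OF assms zero_less_one] by blast
  have *: "(\<Sum>i\<in>A. F (r i) - F (l i)) \<le> real n" if "a \<le> t" "t \<le> b" "t \<le> a + real n * (d / 2)"
     "interval_family A l r a t" for t n and A :: "nat set" and l r
    using that
  proof (induction n arbitrary: t l r)
    case 0
    then have "\<forall>i\<in>A. l i = a \<and> r i = a" unfolding interval_family_def by force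
    then show ?case by simp
  next
    case (Suc n)
    \<comment> \<open>The piece cut off on the right has length at most \<open>d / 2\<close>,
      strictly below \<open>d\<close>; the maximum covers the case that less than
      \<open>d / 2\<close> is left.\<close>
    let ?t = "max a (t - d / 2)"
    have t: "a \<le> ?t" "?t \<le> t" using d Suc.prems by auto
    note sp = interval_family_split[OF Suc.prems(4) t]
    have "(\<Sum>i\<in>A. F (min ?t (r i)) - F (min ?t (l i))) \<le> real n"
      using Suc.prems t by (intro Suc.IH[OF _ _ _ sp(1)]) (auto simp: algebra_simps add_divide_distrib)
    moreover have "interval_family A (\<lambda>i. max ?t (l i)) (\<lambda>i. max ?t (r i)) a b"
      by (rule interval_family_mono[OF sp(2)]) (use Suc.prems in auto)
    then have "(\<Sum>i\<in>A. \<bar>F (max ?t (r i)) - F (max ?t (l i))\<bar>) < 1"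
    proof (rule d(2))
      have "(\<Sum>i\<in>A. max ?t (r i) - max ?t (l i)) \<le> t - ?t"
        using interval_family_length[OF sp(2)] t by simp
      then show "(\<Sum>i\<in>A. max ?t (r i) - max ?t (l i)) < d" using d(1) by linarith
    qed
    then have "(\<Sum>i\<in>A. F (max ?t (r i)) - F (max ?t (l i))) < 1"
      by (rule le_less_trans[rotated]) (intro sum_mono abs_ge_self)
    ultimately show ?case using sp(3)[of F] by simp
  qed
  obtain n where "b - a < real n * (d / 2)" using d(1) reals_Archimedean3[of "d / 2"] half_gt_zero by blast
  then have "b \<le> a + real n * (d / 2)" by linarith
  from *[OF True order_refl this] show ?thesis by (intro exI[of _ "real n"] allI impI)
qed

context
  fixes F a b assumes F: "AC_on {a..b} F"
begin

lemma positive_variation_upper: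
  assumes "interval_family (A::nat set) l r s t" "a \<le> s" "t \<le> b"
  shows "(\<Sum>i\<in>A. F (r i) - F (l i)) \<le> positive_variation F s t"
proof -
  obtain B where "\<forall>(A::nat set) l r. interval_family A l r a b \<longrightarrow> (\<Sum>i\<in>A. F (r i) - F (l i)) \<le> B"
    using positive_variation_bounded[OF F] by blast
  then have "bdd_above {\<Sum>i\<in>A. F (r i) - F (l i) | (A::nat set) l r. interval_family A l r s t}"
    using assms by (intro bdd_aboveI[of _ B]) (auto intro: interval_family_mono)
  then show ?thesis unfolding positive_variation_def
    by (rule cSup_upper[rotated]) (use assms in blast)
qed

lemma positive_variation_least:
  assumes "\<And>(A::nat set) l r. interval_family A l r s t \<Longrightarrow> (\<Sum>i\<in>A. F (r i) - F (l i)) \<le> B"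
  shows "positive_variation F s t \<le> B"
  unfolding positive_variation_def
proof (rule cSup_least)
  have "interval_family ({} :: nat set) (\<lambda>_. 0) (\<lambda>_. 0) s t" by simp
  then show "{\<Sum>i\<in>A. F (r i) - F (l i) | (A::nat set) l r. interval_family A l r s t} \<noteq> {}" by blast
qed (use assms in auto)

lemma positive_variation_approx:
  assumes "a \<le> s" "t \<le> b" "\<eta> > 0"
  obtains A :: "nat set" and l r where "interval_family A l r s t"
    "positive_variation F s t < (\<Sum>i\<in>A. F (r i) - F (l i)) + \<eta>"
proof -
  have "\<not> (\<forall>(A::nat set) l r. interval_family A l r s t \<longrightarrow>
     (\<Sum>i\<in>A. F (r i) - F (l i)) \<le> positive_variation F s t - \<eta>)"
    using positive_variation_least[of s t "positive_variation F s t - \<eta>"] \<open>\<eta> > 0\<close>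
    by (metis diff_ge_0_iff_ge diff_gt_0_iff_gt leD less_add_same_cancel1 less_diff_eq diff_less_eq)
  then obtain A :: "nat set" and l r where A: "interval_family A l r s t"
     "\<not> (\<Sum>i\<in>A. F (r i) - F (l i)) \<le> positive_variation F s t - \<eta>" by blast
  show thesis by (rule that[OF A(1)]) (use A(2) in linarith)
qed

lemma positive_variation_subadditive:
  assumes "a \<le> s" "s \<le> t" "t \<le> u" "u \<le> b"
  shows "positive_variation F s u \<le> positive_variation F s t + positive_variation F t u"
proof (rule positive_variation_least)
  fix A :: "nat set" and l r assume A: "interval_family A l r s u"
  note sp = interval_family_split[OF A assms(2,3)]
  show "(\<Sum>i\<in>A. F (r i) - F (l i)) \<le> positive_variation F s t + positive_variation F t u"
    unfolding sp(3)[of F] using assms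
    by (intro add_mono positive_variation_upper[OF sp(1)] positive_variation_upper[OF sp(2)]) auto
qed

lemma positive_variation_mono:
  assumes "a \<le> s" "t \<le> u" "u \<le> b"
  shows "positive_variation F s t \<le> positive_variation F s u"
proof (rule positive_variation_least)
  fix A :: "nat set" and l r assume "interval_family A l r s t"
  then have "interval_family A l r s u" using assms by (metis interval_family_mono order_refl)
  then show "(\<Sum>i\<in>A. F (r i) - F (l i)) \<le> positive_variation F s u"
    by (rule positive_variation_upper) (use assms in auto)
qed

text \<open>Any family in \<open>{s..t}\<close> can be extended by \<open>{t..u}\<close> under a
  fresh index, which exists because the index type is infinite. With s = a this makes
  \<open>positive_variation F a x - F x\<close> nondecreasing in \<open>x\<close>.\<close>

lemma positive_variation_add_increment:
  assumes "a \<le> s" "s \<le> t" "t \<le> u" "u \<le> b"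
  shows "positive_variation F s t + (F u - F t) \<le> positive_variation F s u"
proof -
  have "positive_variation F s t \<le> positive_variation F s u - (F u - F t)"
  proof (rule positive_variation_least)
    fix A :: "nat set" and l r assume A: "interval_family A l r s t"
    then have fin: "finite A" by (simp add: interval_family_def)
    then obtain n where n: "n \<notin> A" by (meson ex_new_if_finite infinite_UNIV_nat)
    have "(\<Sum>i\<in>insert n A. F ((r(n := u)) i) - F ((l(n := t)) i)) \<le> positive_variation F s u"
    proof (rule positive_variation_upper)
      have "\<forall>i\<in>A. r i \<le> t" using A by (simp add: interval_family_def)
      then have "{l i<..<r i} \<inter> {t<..<u} = {}" if "i \<in> A" for i using that by force
      then show "interval_family (insert n A) (l(n := t)) (r(n := u)) s u"
        using A n assms unfolding interval_family_def by (auto simp: Int_commute)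
    qed (use assms in auto)
    also have "(\<Sum>i\<in>insert n A. F ((r(n := u)) i) - F ((l(n := t)) i)) = (F u - F t) + (\<Sum>i\<in>A. F (r i) - F (l i))"
      using n fin by (simp add: sum.insert) (intro sum.cong, auto)
    finally show "(\<Sum>i\<in>A. F (r i) - F (l i)) \<le> positive_variation F s u - (F u - F t)" by linarith
  qed
  then show ?thesis by simp
qed

text \<open>The increase over each interval is at most the positive variation inside it, hence
  nearly attained by a finite subfamily. All subfamilies together form one family of no greater
  total length, to which the absolute continuity of \<open>F\<close> applies.\<close>

lemma AC_on_positive_variation: "AC_on {a..b} (positive_variation F a)"
proof (rule AC_onI)
  fix \<epsilon> :: real assume "\<epsilon> > 0"
  then have e: "\<epsilon> / 2 > 0" by simp
  obtain d where d: "d > 0" "\<And>(A::(real set \<times> nat) set) l r. interval_family A l r a b \<Longrightarrow> (\<Sum>i\<in>A. r i - l i) < d \<Longrightarrow>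
     (\<Sum>i\<in>A. \<bar>F (r i) - F (l i)\<bar>) < \<epsilon> / 2" using AC_onE[OF F e] by blast
  show "\<exists>\<delta>>0. \<forall>(A::real set set) l r. interval_family A l r a b \<longrightarrow>
     (\<Sum>i\<in>A. r i - l i) < \<delta> \<longrightarrow>
     (\<Sum>i\<in>A. \<bar>positive_variation F a (r i) - positive_variation F a (l i)\<bar>) < \<epsilon>"
  proof (intro exI[of _ d] conjI allI impI)
    fix A :: "real set set" and l r assume A: "interval_family A l r a b" and len: "(\<Sum>i\<in>A. r i - l i) < d"
    have fin: "finite A" and lr: "\<And>i. i \<in> A \<Longrightarrow> a \<le> l i \<and> l i \<le> r i \<and> r i \<le> b"
      using A by (auto simp: interval_family_def)
    \<comment> \<open>One approximation error per interval; together they stay within \<epsilon> /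
      2. The added 1 keeps \<open>\<eta>\<close> positive when \<open>A\<close> is empty.\<close>
    define \<eta> where "\<eta> = \<epsilon> / 2 / (real (card A) + 1)"
    have \<eta>: "\<eta> > 0" "real (card A) * \<eta> \<le> \<epsilon> / 2" using e by (auto simp: \<eta>_def field_simps)
    have "\<forall>i\<in>A. \<exists>(X::nat set) l' r'. interval_family X l' r' (l i) (r i) \<and>
       positive_variation F (l i) (r i) < (\<Sum>j\<in>X. F (r' j) - F (l' j)) + \<eta>"
      using positive_variation_approx lr \<eta>(1) by metis
    then obtain X :: "real set \<Rightarrow> nat set" and l' r' where
      X: "\<And>i. i \<in> A \<Longrightarrow> interval_family (X i) (l' i) (r' i) (l i) (r i)" and
      ap: "\<And>i. i \<in> A \<Longrightarrow> positive_variation F (l i) (r i) < (\<Sum>j\<in>X i. F (r' i j) - F (l' i j)) + \<eta>"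
      by metis
    have finX: "finite (X i)" if "i \<in> A" for i using X[OF that] by (simp add: interval_family_def)
    let ?S = "Sigma A X" and ?l = "\<lambda>(i, j). l' i j" and ?r = "\<lambda>(i, j). r' i j"
    have fS: "interval_family ?S ?l ?r a b"
      unfolding interval_family_def
    proof (intro conjI ballI impI)
      show "finite ?S" using fin finX by auto
      fix p assume "p \<in> ?S"
      then obtain i j where p: "p = (i, j)" "i \<in> A" "j \<in> X i" by auto
      have "l i \<le> l' i j" "l' i j \<le> r' i j" "r' i j \<le> r i" using X[OF p(2)] p(3) by (auto simp: interval_family_def)
      then show "a \<le> ?l p" "?l p \<le> ?r p" "?r p \<le> b" using lr[OF p(2)] p(1) by auto
    next
      fix p p' assume pp: "p \<in> ?S" "p' \<in> ?S" "p \<noteq> p'"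
      obtain i j where p: "p = (i, j)" "i \<in> A" "j \<in> X i" using pp by auto
      obtain i' j' where p': "p' = (i', j')" "i' \<in> A" "j' \<in> X i'" using pp by auto
      have sub: "{l' i j<..<r' i j} \<subseteq> {l i<..<r i}" "{l' i' j'<..<r' i' j'} \<subseteq> {l i'<..<r i'}"
        using X[OF p(2)] p(3) X[OF p'(2)] p'(3) by (fastforce simp: interval_family_def)+
      show "{?l p<..<?r p} \<inter> {?l p'<..<?r p'} = {}"
      proof (cases "i = i'")
        case True
        then have "j \<noteq> j'" using pp p p' by auto
        then show ?thesis using X[OF p(2)] p p' True by (auto simp: interval_family_def)
      next
        case False
        then have "{l i<..<r i} \<inter> {l i'<..<r i'} = {}" using A p p' by (auto simp: interval_family_def)
        then show ?thesis using sub unfolding p(1) p'(1) case_prod_conv by blast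
      qed
    qed
    have S: "(\<Sum>p\<in>?S. G (?l p) (?r p)) = (\<Sum>i\<in>A. \<Sum>j\<in>X i. G (l' i j) (r' i j))" for G :: "real \<Rightarrow> real \<Rightarrow> real"
      using fin finX by (subst sum.Sigma) (auto simp: case_prod_unfold)
    have "(\<Sum>p\<in>?S. ?r p - ?l p) = (\<Sum>i\<in>A. \<Sum>j\<in>X i. r' i j - l' i j)"
      using S[of "\<lambda>x y. y - x"] by simp
    also have "\<dots> \<le> (\<Sum>i\<in>A. r i - l i)"
      by (intro sum_mono interval_family_length X) (use lr in auto)
    finally have "(\<Sum>p\<in>?S. \<bar>F (?r p) - F (?l p)\<bar>) < \<epsilon> / 2" using d(2)[OF fS] len by linarith
    moreover have "(\<Sum>p\<in>?S. F (?r p) - F (?l p)) \<le> (\<Sum>p\<in>?S. \<bar>F (?r p) - F (?l p)\<bar>)"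
      by (intro sum_mono) simp
    moreover have "(\<Sum>p\<in>?S. F (?r p) - F (?l p)) = (\<Sum>i\<in>A. \<Sum>j\<in>X i. F (r' i j) - F (l' i j))"
      using S[of "\<lambda>x y. F y - F x"] by simp
    ultimately have 1: "(\<Sum>i\<in>A. \<Sum>j\<in>X i. F (r' i j) - F (l' i j)) < \<epsilon> / 2" by linarith
    have "(\<Sum>i\<in>A. \<bar>positive_variation F a (r i) - positive_variation F a (l i)\<bar>)
      \<le> (\<Sum>i\<in>A. (\<Sum>j\<in>X i. F (r' i j) - F (l' i j)) + \<eta>)"
    proof (rule sum_mono)
      fix i assume i: "i \<in> A"
      have "positive_variation F a (l i) \<le> positive_variation F a (r i)"
        by (rule positive_variation_mono) (use lr[OF i] in auto)
      moreover have "positive_variation F a (r i) \<le> positive_variation F a (l i) + positive_variation F (l i) (r i)"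
        by (rule positive_variation_subadditive) (use lr[OF i] in auto)
      ultimately show "\<bar>positive_variation F a (r i) - positive_variation F a (l i)\<bar>
         \<le> (\<Sum>j\<in>X i. F (r' i j) - F (l' i j)) + \<eta>" using ap[OF i] by linarith
    qed
    also have "\<dots> < \<epsilon>" using 1 \<eta>(2) by (simp add: sum.distrib)
    finally show "(\<Sum>i\<in>A. \<bar>positive_variation F a (r i) - positive_variation F a (l i)\<bar>) < \<epsilon>" .
  qed fact
qed

end

text \<open>A null set is enclosed in an open set of small length and then covered by nonoverlapping
  compact intervals inside it. Absolute continuity bounds the total increase of \<open>P\<close>
  over finitely many of them, and this increase is their Stieltjes measure.\<close>

lemma AC_on_mono_integral:
  fixes P :: "real \<Rightarrow> real"
  assumes AC: "AC_on {a..b} P" and mono: "mono_on {a..b} P" and "a < b"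
  obtains h where "h absolutely_integrable_on {a..b}"
    "\<And>t. t \<in> {a..b} \<Longrightarrow> P t - P a = integral {a..t} h"
proof -
  \<comment> \<open>\<open>P\<close> is frozen outside \<open>{a..b}\<close>, so that
    \<open>Q\<close> is monotone and continuous on the whole line, as the Stieltjes measure
    requires.\<close>
  define Q where "Q x = P (max a (min b x))" for x
  have Q_mono: "Q x \<le> Q y" if "x \<le> y" for x y
    unfolding Q_def using that \<open>a < b\<close> by (intro mono_onD[OF mono]) auto
  have Q_cont: "continuous_on UNIV Q"
    unfolding Q_def using \<open>a < b\<close>
    by (intro continuous_on_compose2[OF AC_on_imp_continuous_on[OF AC]] continuous_intros) auto
  then have Q_right: "continuous (at_right x) Q" for x
    by (meson continuous_on_eq_continuous_within continuous_within_subset subset_UNIV UNIV_I)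
  define M where "M = interval_measure Q"
  have sets_M [simp, measurable_cong]: "sets M = sets borel" by (simp add: M_def)
  have M_Icc: "emeasure M {x..y} = ennreal (Q y - Q x)" if "x \<le> y" for x y
    unfolding M_def by (rule emeasure_interval_measure_Icc[OF that Q_mono Q_cont])
  have M_Ioc: "emeasure M {x<..y} = ennreal (Q y - Q x)" if "x \<le> y" for x y
    unfolding M_def by (rule emeasure_interval_measure_Ioc[OF that Q_mono Q_right])
  \<comment> \<open>The restriction lets the covering argument look only at the part of a null set
    inside \<open>{a..b}\<close>.\<close>
  define N where "N = density M (indicator {a<..b})"
  have N_eq: "emeasure N X = emeasure M (X \<inter> {a<..b})" if "X \<in> sets borel" for X
    using that by (simp add: N_def emeasure_restricted Int_commute)
  have null: "emeasure M (X \<inter> {a<..b}) = 0" if X: "X \<in> null_sets lborel" for X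
  proof -
    have Xb: "X \<in> sets borel" using X by auto
    have "emeasure M (X \<inter> {a<..b}) \<le> ennreal \<epsilon>" if \<epsilon>: "\<epsilon> > 0" for \<epsilon>
    proof -
      obtain d where d: "d > 0" "\<And>(A::real set set) l r. interval_family A l r a b \<Longrightarrow> (\<Sum>i\<in>A. r i - l i) < d \<Longrightarrow>
        (\<Sum>i\<in>A. \<bar>P (r i) - P (l i)\<bar>) < \<epsilon>" using AC_onE[OF AC \<epsilon>] by blast
      obtain U where U: "open U" "X \<subseteq> U" "emeasure lborel (U - X) \<le> ennreal (d / 2)"
        using outer_regular_lborel_le[OF Xb, of "d / 2"] d(1) by auto
      have "emeasure lborel U \<le> emeasure lborel (U - X) + emeasure lborel X"
        using U Xb by (intro order_trans[OF emeasure_mono emeasure_subadditive]) auto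
      also have "\<dots> \<le> ennreal (d / 2)" using X U by (simp add: null_setsD1)
      finally have eU: "emeasure lborel U \<le> ennreal (d / 2)" .
      have U_fm: "U \<in> fmeasurable lborel"
        using U(1) le_less_trans[OF eU ennreal_less_top] by (intro fmeasurableI) auto
      have "measure lborel U \<le> d / 2"
        unfolding measure_def by (rule enn2real_leI[OF _ eU]) (use d(1) in simp)
      then have mU: "measure lborel U < d" using d(1) by linarith
      \<comment> \<open>Every cell contains a tag in \<open>X\<close>, hence in \<open>U\<close>,
        where the gauge is \<open>U\<close> itself; so each cell lies in \<open>U\<close>.\<close>
      obtain D where D: "countable D" "\<Union>D \<subseteq> cbox a b"
        "\<And>K. K \<in> D \<Longrightarrow> interior K \<noteq> {} \<and> (\<exists>c d. K = cbox c d)"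
        "pairwise (\<lambda>A B. interior A \<inter> interior B = {}) D"
        "\<And>K. K \<in> D \<Longrightarrow> \<exists>x \<in> (X \<inter> {a..b}) \<inter> K. K \<subseteq> (if x \<in> U then U else UNIV)"
        "X \<inter> {a..b} \<subseteq> \<Union>D"
      proof (rule covering_lemma[of "X \<inter> {a..b}" a b "\<lambda>x. if x \<in> U then U else UNIV"])
        show "gauge (\<lambda>x. if x \<in> U then U else UNIV)" using U(1) by (auto simp: gauge_def)
      qed (use \<open>a < b\<close> in auto)
      have DU: "K \<subseteq> U" if "K \<in> D" for K using D(5)[OF that] U(2) by (auto split: if_splits)
      have Dm: "K \<in> fmeasurable M" if K: "K \<in> D" for K
      proof -
        obtain c e where "K = {c..e}" "c \<le> e" using D(3)[OF K] by (metis box_real(2) atLeastatMost_empty_iff interior_empty)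
        then show ?thesis using M_Icc by (auto simp: fmeasurable_def)
      qed
      \<comment> \<open>Absolute continuity speaks of finite families only; the uniform bound passes
        to the countable union afterwards.\<close>
      have bound: "measure M (\<Union>E) \<le> \<epsilon>" if E: "E \<subseteq> D" "finite E" for E
      proof -
        have div: "E division_of \<Union>E"
        proof (rule division_ofI)
          fix K assume "K \<in> E"
          then have "K \<in> D" using E by auto
          from D(3)[OF this] show "K \<noteq> {}" "\<exists>a b. K = cbox a b" by auto
        next
          fix K1 K2 assume "K1 \<in> E" "K2 \<in> E" "K1 \<noteq> K2"
          then show "interior K1 \<inter> interior K2 = {}" using E D(4) by (auto simp: pairwise_def)
        qed (use E in auto)
        have E_ab: "\<Union>E \<subseteq> {a..b}" using D(2) E by auto
        note fam = division_interval_family[OF div E_ab]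
        have "(\<Sum>k\<in>E. Sup k - Inf k) = (\<Sum>k\<in>E. measure lebesgue k)"
        proof (rule sum.cong[OF refl])
          fix k assume "k \<in> E"
          then show "Sup k - Inf k = measure lebesgue k" using fam(2)[of k] by (metis measure_lborel_Icc measure_completion sets_lborel borel_closed closed_real_atLeastAtMost)
        qed
        also have "\<dots> = measure lebesgue (\<Union>E)" by (rule content_division[OF div])
        also have "\<dots> \<le> measure lebesgue U"
          using U_fm DU E div by (intro measure_mono_fmeasurable)
            (auto simp: fmeasurable_def emeasure_completion intro!: sets.finite_Union dest: D(3))
        also have "\<dots> < d" using mU U(1) by simp
        finally have "(\<Sum>k\<in>E. \<bar>P (Sup k) - P (Inf k)\<bar>) < \<epsilon>" by (rule d(2)[OF fam(1)])
        moreover have "measure M k = \<bar>P (Sup k) - P (Inf k)\<bar>" if k: "k \<in> E" for k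
        proof -
          have *: "a \<le> Inf k" "Inf k \<le> Sup k" "Sup k \<le> b" using fam(1) k by (auto simp: interval_family_def)
          have "emeasure M k = ennreal (Q (Sup k) - Q (Inf k))"
            using M_Icc[OF *(2)] fam(2)[OF k] by simp
          then have "measure M k = Q (Sup k) - Q (Inf k)"
            using Q_mono[OF *(2)] by (simp add: measure_def)
          also have "\<dots> = \<bar>P (Sup k) - P (Inf k)\<bar>"
            using * Q_mono[OF *(2)] \<open>a < b\<close> by (simp add: Q_def)
          finally show ?thesis .
        qed
        moreover have "measure M (\<Union>E) \<le> (\<Sum>k\<in>E. measure M k)"
          using measure_UNION_le[of E "\<lambda>k. k" M] E fmeasurableD[OF Dm] by (simp add: subset_iff)
        ultimately show ?thesis by simp
      qed
      have "(\<Union>K\<in>D. K) \<in> fmeasurable M" "measure M (\<Union>K\<in>D. K) \<le> \<epsilon>"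
        by (rule fmeasurable_UN_bound[OF D(1) Dm, where B=\<epsilon>] measure_UN_bound[OF D(1) Dm, where B=\<epsilon>];
            use bound in simp)+
      then have "emeasure M (\<Union>D) \<le> ennreal \<epsilon>"
        by (simp add: emeasure_eq_measure2 ennreal_leI)
      moreover have "emeasure M (X \<inter> {a<..b}) \<le> emeasure M (\<Union>D)"
        using D(6) \<open>(\<Union>K\<in>D. K) \<in> fmeasurable M\<close> by (intro emeasure_mono) auto
      ultimately show ?thesis by (rule order_trans[rotated])
    qed
    then show ?thesis
      by (metis ennreal_0 ennreal_le_epsilon le_zero_eq add_0 ennreal_zero_neq_top)
  qed
  have "absolutely_continuous lborel N"
    unfolding absolutely_continuous_def using null N_eq by (auto simp: null_sets_def N_def)
  then obtain f where f [measurable]: "f \<in> borel_measurable lborel" and fN: "density lborel f = N"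
    using sigma_finite_measure.Radon_Nikodym[of lborel N] sigma_finite_lborel by (auto simp: N_def)
  have int_f: "(\<integral>\<^sup>+x. f x * indicator {a<..t} x \<partial>lborel) = ennreal (P t - P a)" if t: "t \<in> {a..b}" for t
  proof -
    have "(\<integral>\<^sup>+x. f x * indicator {a<..t} x \<partial>lborel) = emeasure N {a<..t}"
      unfolding fN[symmetric] by (simp add: emeasure_density)
    also have "\<dots> = emeasure M {a<..t}" using N_eq[of "{a<..t}"] t by (simp add: Int_absorb2)
    also have "\<dots> = ennreal (P t - P a)" using M_Ioc[of a t] t \<open>a < b\<close> by (simp add: Q_def)
    finally show ?thesis .
  qed
  have "(\<integral>\<^sup>+x. f x * indicator {a<..b} x \<partial>lborel) \<noteq> \<infinity>" using int_f[of b] \<open>a < b\<close> by simp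
  then have fin: "AE x in lborel. f x * indicator {a<..b} x \<noteq> \<infinity>"
    by (intro nn_integral_PInf_AE) auto
  \<comment> \<open>Infinite values of the density, confined to a null set of
    \<open>{a<..b}\<close>, become 0. The indicator makes \<open>h a\<close> zero, so cutting
    \<open>h\<close> off to \<open>{a<..t}\<close> or to \<open>{a..t}\<close> gives the same
    function.\<close>
  define h where "h x = enn2real (f x) * indicator {a<..b} x" for x
  have hI: "(h has_integral (P t - P a)) {a..t}" if t: "t \<in> {a..b}" for t
  proof -
    have Pt: "P a \<le> P t" using t by (intro mono_onD[OF mono]) auto
    have "(\<integral>\<^sup>+x. ennreal (h x * indicator {a<..t} x) \<partial>lborel) = (\<integral>\<^sup>+x. f x * indicator {a<..t} x \<partial>lborel)"
      using fin by (intro nn_integral_cong_AE) (use t in \<open>auto simp: h_def indicator_def less_top\<close>)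
    also have "\<dots> = ennreal (P t - P a)" by (rule int_f[OF t])
    finally have "((\<lambda>x. h x * indicator {a<..t} x) has_integral (P t - P a)) UNIV"
      using Pt by (intro nn_integral_has_integral) (auto simp: h_def)
    moreover have "(\<lambda>x. h x * indicator {a<..t} x) = (\<lambda>x. if x \<in> {a..t} then h x else 0)"
      by (auto simp: h_def fun_eq_iff indicator_def)
    ultimately show ?thesis by (simp only: has_integral_restrict_UNIV)
  qed
  show thesis
  proof
    show "h absolutely_integrable_on {a..b}"
      using hI[of b] \<open>a < b\<close> by (intro nonnegative_absolutely_integrable_1) (auto simp: h_def)
    show "P t - P a = integral {a..t} h" if "t \<in> {a..b}" for t
      using hI[OF that] by (simp add: integral_unique)
  qed
qed

lemma AC_on_integral:
  fixes F :: "real \<Rightarrow> real"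
  assumes AC: "AC_on {a..b} F" and "a < b"
  obtains h where "h absolutely_integrable_on {a..b}"
    "\<And>t. t \<in> {a..b} \<Longrightarrow> F t - F a = integral {a..t} h"
proof -
  let ?P = "positive_variation F a"
  have AP: "AC_on {a..b} ?P" by (rule AC_on_positive_variation[OF AC])
  have mP: "mono_on {a..b} ?P"
    by (intro mono_onI positive_variation_mono[OF AC]) auto
  have mQ: "mono_on {a..b} (\<lambda>x. ?P x - F x)"
  proof (rule mono_onI)
    fix r s assume "r \<in> {a..b}" "s \<in> {a..b}" "r \<le> s"
    then show "?P r - F r \<le> ?P s - F s"
      using positive_variation_add_increment[OF AC, of a r s] by auto
  qed
  obtain h where h: "h absolutely_integrable_on {a..b}"
    "\<And>t. t \<in> {a..b} \<Longrightarrow> ?P t - ?P a = integral {a..t} h"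
    using AC_on_mono_integral[OF AP mP \<open>a < b\<close>] by blast
  obtain k where k: "k absolutely_integrable_on {a..b}"
    "\<And>t. t \<in> {a..b} \<Longrightarrow> (?P t - F t) - (?P a - F a) = integral {a..t} k"
    using AC_on_mono_integral[OF AC_on_diff[OF AP AC] mQ \<open>a < b\<close>] by blast
  show thesis
  proof
    show "(\<lambda>x. h x - k x) absolutely_integrable_on {a..b}" using h(1) k(1) by (rule set_integral_diff(1))
    fix t assume t: "t \<in> {a..b}"
    have "h integrable_on {a..t}" "k integrable_on {a..t}"
      using h(1) k(1) t by (auto intro: integrable_on_subinterval[where S="{a..b}"] dest: set_lebesgue_integral_eq_integral(1))
    then show "F t - F a = integral {a..t} (\<lambda>x. h x - k x)"
      using h(2)[OF t] k(2)[OF t] by (simp add: integral_diff)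
  qed
qed

text \<open>Split the absolute value of \<open>g\<close> at height \<open>n\<close>: by dominated
  convergence the excess has integral below \<epsilon> / 2 for some \<open>n\<close>, and the part
  below \<open>n\<close> contributes at most \<open>n\<close> times the total length.\<close>

lemma AC_on_indefinite_integral:
  fixes g :: "real \<Rightarrow> real"
  assumes g: "g absolutely_integrable_on {a..b}"
  shows "AC_on {a..b} (\<lambda>t. integral {a..t} g)"
proof (rule AC_onI)
  fix \<epsilon> :: real assume \<epsilon>: "\<epsilon> > 0"
  let ?u = "\<lambda>n x. min \<bar>g x\<bar> (real n)"
  have ag: "(\<lambda>x. \<bar>g x\<bar>) absolutely_integrable_on {a..b}" using absolutely_integrable_norm[OF g] by (simp add: o_def)
  have au: "?u n absolutely_integrable_on {a..b}" for n
    by (intro absolutely_integrable_min_1 ag) (auto simp: absolutely_integrable_on_def)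
  have I: "k integrable_on {a..b}" if "k absolutely_integrable_on {a..b}" for k :: "real \<Rightarrow> real"
    using that set_lebesgue_integral_eq_integral(1) by blast
  have "(\<lambda>n. integral {a..b} (?u n)) \<longlonglongrightarrow> integral {a..b} (\<lambda>x. \<bar>g x\<bar>)"
  proof (rule dominated_convergence(2))
    show "?u n integrable_on {a..b}" for n by (rule I[OF au])
    show "(\<lambda>x. \<bar>g x\<bar>) integrable_on {a..b}" by (rule I[OF ag])
    show "norm (?u n x) \<le> \<bar>g x\<bar>" for n x by auto
    fix x
    have "eventually (\<lambda>n. ?u n x = \<bar>g x\<bar>) sequentially"
      using eventually_ge_at_top[of "nat \<lceil>\<bar>g x\<bar>\<rceil>"] by eventually_elim linarith
    then show "(\<lambda>n. ?u n x) \<longlonglongrightarrow> \<bar>g x\<bar>" by (rule tendsto_eventually)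
  qed
  then have "\<forall>\<^sub>F n in sequentially. dist (integral {a..b} (?u n)) (integral {a..b} (\<lambda>x. \<bar>g x\<bar>)) < \<epsilon> / 2"
    using \<epsilon> by (intro tendstoD) auto
  then obtain n where n: "dist (integral {a..b} (?u n)) (integral {a..b} (\<lambda>x. \<bar>g x\<bar>)) < \<epsilon> / 2"
    by (auto simp: eventually_sequentially)
  let ?w = "\<lambda>x. \<bar>g x\<bar> - ?u n x"
  have iw: "?w integrable_on {a..b}" using I[OF ag] I[OF au[of n]] by (rule integrable_diff)
  have w: "integral {a..b} ?w < \<epsilon> / 2"
    using n integral_diff[OF I[OF ag] I[OF au[of n]]] unfolding dist_real_def by linarith
  \<comment> \<open>Makes \<open>real n * d\<close> at most \<epsilon> / 2; the added 1 covers n =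
    0.\<close>
  define d where "d = \<epsilon> / (2 * (real n + 1))"
  show "\<exists>\<delta>>0. \<forall>(A::real set set) l r. interval_family A l r a b \<longrightarrow>
     (\<Sum>i\<in>A. r i - l i) < \<delta> \<longrightarrow> (\<Sum>i\<in>A. \<bar>integral {a..r i} g - integral {a..l i} g\<bar>) < \<epsilon>"
  proof (intro exI[of _ d] conjI allI impI)
    show "d > 0" using \<epsilon> by (simp add: d_def)
    fix A :: "real set set" and l r assume A: "interval_family A l r a b" and len: "(\<Sum>i\<in>A. r i - l i) < d"
    have fin: "finite A" and lr: "\<And>i. i \<in> A \<Longrightarrow> a \<le> l i \<and> l i \<le> r i \<and> r i \<le> b"
      using A by (auto simp: interval_family_def)
    have sub: "k integrable_on {l i..r i}" if "i \<in> A" "k integrable_on {a..b}" for i and k :: "real \<Rightarrow> real"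
      using that lr[of i] by (auto intro: integrable_on_subinterval)
    have "\<bar>integral {a..r i} g - integral {a..l i} g\<bar> \<le> integral {l i..r i} ?w + real n * (r i - l i)" if i: "i \<in> A" for i
    proof -
      have "integral {a..l i} g + integral {l i..r i} g = integral {a..r i} g"
        using lr[OF i] I[OF g] by (intro Henstock_Kurzweil_Integration.integral_combine) (auto intro: integrable_on_subinterval)
      then have "\<bar>integral {a..r i} g - integral {a..l i} g\<bar> = norm (integral {l i..r i} g)" by auto
      also have "\<dots> \<le> integral {l i..r i} (\<lambda>x. ?w x + real n)"
        using sub[OF i I[OF g]] sub[OF i iw]
        by (intro integral_norm_bound_integral integrable_add) auto
      also have "\<dots> = integral {l i..r i} ?w + real n * (r i - l i)"
        using sub[OF i iw] lr[OF i] by (subst integral_add) auto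
      finally show ?thesis .
    qed
    then have "(\<Sum>i\<in>A. \<bar>integral {a..r i} g - integral {a..l i} g\<bar>)
      \<le> (\<Sum>i\<in>A. integral {l i..r i} ?w + real n * (r i - l i))" by (rule sum_mono)
    also have "\<dots> = (\<Sum>i\<in>A. integral {l i..r i} ?w) + real n * (\<Sum>i\<in>A. r i - l i)"
      by (simp add: sum.distrib sum_distrib_left)
    also have "(\<Sum>i\<in>A. integral {l i..r i} ?w) \<le> integral {a..b} ?w"
    proof -
      \<comment> \<open>The open intervals are pairwise disjoint, whereas the compact ones may share
        endpoints.\<close>
      have "(?w has_integral integral {l i..r i} ?w) {l i<..<r i}" if "i \<in> A" for i
        using integrable_integral[OF sub[OF that iw]] by (simp only: has_integral_Icc_iff_Ioo)
      then have U: "(?w has_integral (\<Sum>i\<in>A. integral {l i..r i} ?w)) (\<Union>i\<in>A. {l i<..<r i})"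
        by (rule has_integral_UN[OF fin]) (use A in \<open>auto simp: pairwise_def interval_family_def\<close>)
      have "(\<Sum>i\<in>A. integral {l i..r i} ?w) = integral (\<Union>i\<in>A. {l i<..<r i}) ?w"
        using U by (simp add: integral_unique)
      also have "\<dots> \<le> integral {a..b} ?w"
        using lr U iw by (intro integral_subset_le) (force dest: has_integral_integrable)+
      finally show ?thesis .
    qed
    also have "real n * (\<Sum>i\<in>A. r i - l i) \<le> real n * d" using len by (intro mult_left_mono) auto
    also have "real n * d \<le> \<epsilon> / 2" using \<epsilon> by (simp add: d_def field_simps)
    finally show "(\<Sum>i\<in>A. \<bar>integral {a..r i} g - integral {a..l i} g\<bar>) < \<epsilon>" using w by linarith
  qed
qed

section \<open>Convolution with the fractional kernel\<close>

text \<open>Extended by 0, the kernel turns an integral over \<open>{a..t}\<close> into a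
  convolution over the whole line. The value 0 at u = 0 agrees with \<open>0 powr x = 0\<close> in
  \<open>RL_integral_raw\<close>, even for order 1.\<close>

definition frac_kernel :: "real \<Rightarrow> real \<Rightarrow> real" where
  "frac_kernel \<alpha> u = (if 0 < u then 1 / Gamma \<alpha> * u powr (\<alpha> - 1) else 0)"

definition frac_conv :: "real \<Rightarrow> (real \<Rightarrow> real) \<Rightarrow> real \<Rightarrow> real" where
  "frac_conv \<alpha> \<phi> t = (LINT \<tau>|lborel. frac_kernel \<alpha> (t - \<tau>) * \<phi> \<tau>)"

lemma frac_kernel_nonneg: "0 < \<alpha> \<Longrightarrow> 0 \<le> frac_kernel \<alpha> u"
  by (simp add: frac_kernel_def Gamma_real_pos less_imp_le)

lemma frac_kernel_nonpos_arg [simp]: "u \<le> 0 \<Longrightarrow> frac_kernel \<alpha> u = 0"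
  by (simp add: frac_kernel_def)

lemma frac_kernel_1: "frac_kernel 1 u = indicator {0<..} u"
  by (simp add: frac_kernel_def indicator_def)

lemma measurable_frac_kernel [measurable]: "frac_kernel \<alpha> \<in> borel_measurable borel"
  unfolding frac_kernel_def by measurable

text \<open>From order 1 on, the exponent is nonnegative and the kernel has no singularity at 0; its
  value at t - a then dominates its values at t - s for all s \<ge> a.\<close>

lemma frac_kernel_le:
  assumes "1 \<le> \<gamma>" "u \<le> v"
  shows "frac_kernel \<gamma> u \<le> frac_kernel \<gamma> v"
proof (cases "0 < u")
  case True
  then show ?thesis using assms
    by (auto simp: frac_kernel_def intro!: divide_right_mono powr_mono2 less_imp_le[OF Gamma_real_pos])
qed (use assms frac_kernel_nonneg[of \<gamma> v] in simp)

text \<open>The substitution \<tau> = s + (t - s) x produces the Beta integral. Nonnegative extended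
  integrals give finiteness together with the value.\<close>

lemma nn_integral_frac_kernel_convolution:
  assumes "0 < \<alpha>" "0 < \<beta>"
  shows "(\<integral>\<^sup>+\<tau>. ennreal (frac_kernel \<alpha> (t - \<tau>) * frac_kernel \<beta> (\<tau> - s)) \<partial>lborel)
    = ennreal (frac_kernel (\<alpha> + \<beta>) (t - s))"
proof (cases "s < t")
  case False
  then have "frac_kernel \<alpha> (t - \<tau>) * frac_kernel \<beta> (\<tau> - s) = 0" for \<tau>
    by (simp add: frac_kernel_def)
  then show ?thesis using False by (simp only:) simp
next
  case True
  define c where "c = t - s"
  have c: "c > 0" using True by (simp add: c_def)
  let ?K = "c powr (\<alpha> + \<beta> - 2) / (Gamma \<alpha> * Gamma \<beta>)"
  let ?b = "\<lambda>x. x powr (\<beta> - 1) * (1 - x) powr (\<alpha> - 1)"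
  have G: "Gamma \<alpha> > 0" "Gamma \<beta> > 0" "Gamma (\<alpha> + \<beta>) > 0" using assms by (auto intro: Gamma_real_pos)
  have "(\<integral>\<^sup>+\<tau>. ennreal (frac_kernel \<alpha> (t - \<tau>) * frac_kernel \<beta> (\<tau> - s)) \<partial>lborel)
     = ennreal \<bar>c\<bar> * (\<integral>\<^sup>+x. ennreal (frac_kernel \<alpha> (t - (s + c * x)) * frac_kernel \<beta> ((s + c * x) - s)) \<partial>lborel)"
    using c by (intro nn_integral_real_affine) auto
  also have "(\<integral>\<^sup>+x. ennreal (frac_kernel \<alpha> (t - (s + c * x)) * frac_kernel \<beta> ((s + c * x) - s)) \<partial>lborel)
     = (\<integral>\<^sup>+x. ennreal ?K * (ennreal (?b x) * indicator {0<..<1} x) \<partial>lborel)"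
  proof (intro nn_integral_cong)
    fix x :: real
    have tx: "t - (s + c * x) = c * (1 - x)" by (simp add: c_def algebra_simps)
    show "ennreal (frac_kernel \<alpha> (t - (s + c * x)) * frac_kernel \<beta> ((s + c * x) - s))
       = ennreal ?K * (ennreal (?b x) * indicator {0<..<1} x)"
    proof (cases "0 < x \<and> x < 1")
      case True
      have cc: "c powr (\<alpha> + \<beta> - 2) = c powr (\<alpha> - 1) * c powr (\<beta> - 1)"
        by (simp add: powr_add[symmetric])
      have "(c * (1 - x)) powr (\<alpha> - 1) = c powr (\<alpha> - 1) * (1 - x) powr (\<alpha> - 1)"
        "(c * x) powr (\<beta> - 1) = c powr (\<beta> - 1) * x powr (\<beta> - 1)"
        using True c by (simp_all add: powr_mult)
      then have "frac_kernel \<alpha> (c * (1 - x)) * frac_kernel \<beta> (c * x) = ?K * ?b x"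
        using True c by (simp add: frac_kernel_def cc)
      moreover have "ennreal (?K * ?b x) = ennreal ?K * ennreal (?b x)"
        using G by (intro ennreal_mult) auto
      ultimately show ?thesis using True by (simp only: tx) simp
    next
      case False
      then have z: "frac_kernel \<alpha> (c * (1 - x)) * frac_kernel \<beta> (c * x) = 0"
        using c by (auto simp: frac_kernel_def zero_less_mult_iff)
      show ?thesis using False by (simp only: tx add_diff_cancel_left' z) simp
    qed
  qed
  also have "\<dots> = ennreal ?K * (\<integral>\<^sup>+x. ennreal (?b x) * indicator {0<..<1} x \<partial>lborel)"
    by (rule nn_integral_cmult) measurable
  also have "(\<integral>\<^sup>+x. ennreal (?b x) * indicator {0<..<1} x \<partial>lborel) = ennreal (Beta \<beta> \<alpha>)"
    using has_integral_Beta_real[of \<beta> \<alpha>] assms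
    by (intro nn_integral_has_integral_lebesgue') (auto simp: has_integral_Icc_iff_Ioo)
  also have "ennreal \<bar>c\<bar> * (ennreal ?K * ennreal (Beta \<beta> \<alpha>)) = ennreal (c * (?K * Beta \<beta> \<alpha>))"
  proof -
    have "ennreal \<bar>c\<bar> * (ennreal x * ennreal y) = ennreal (c * (x * y))" if "0 \<le> x" "0 \<le> y" for x y
      using c that by (simp add: ennreal_mult)
    then show ?thesis using G by (simp add: Beta_def add.commute[of \<alpha>])
  qed
  also have "c * (?K * Beta \<beta> \<alpha>) = frac_kernel (\<alpha> + \<beta>) (t - s)"
  proof -
    have "c * c powr (\<alpha> + \<beta> - 2) = c powr 1 * c powr (\<alpha> + \<beta> - 2)" using c by simp
    also have "\<dots> = c powr (\<alpha> + \<beta> - 1)" unfolding powr_add[symmetric] by (simp add: algebra_simps)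
    finally show ?thesis using c G by (simp add: frac_kernel_def c_def[symmetric] Beta_def add.commute field_simps)
  qed
  finally show ?thesis .
qed

lemma frac_kernel_convolution:
  assumes "0 < \<alpha>" "0 < \<beta>"
  shows "integrable lborel (\<lambda>\<tau>. frac_kernel \<alpha> (t - \<tau>) * frac_kernel \<beta> (\<tau> - s))"
    and "(LINT \<tau>|lborel. frac_kernel \<alpha> (t - \<tau>) * frac_kernel \<beta> (\<tau> - s)) = frac_kernel (\<alpha> + \<beta>) (t - s)"
proof -
  note nn = nn_integral_frac_kernel_convolution[OF assms, of t s]
  have nonneg: "0 \<le> frac_kernel \<alpha> (t - \<tau>) * frac_kernel \<beta> (\<tau> - s)" for \<tau>
    using assms by (simp add: frac_kernel_nonneg)
  show "integrable lborel (\<lambda>\<tau>. frac_kernel \<alpha> (t - \<tau>) * frac_kernel \<beta> (\<tau> - s))"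
    by (rule integrableI_nonneg) (auto simp: nonneg nn)
  show "(LINT \<tau>|lborel. frac_kernel \<alpha> (t - \<tau>) * frac_kernel \<beta> (\<tau> - s)) = frac_kernel (\<alpha> + \<beta>) (t - s)"
    using assms by (subst integral_eq_nn_integral) (auto simp: nonneg nn frac_kernel_nonneg)
qed

text \<open>
  The order \<open>\<alpha> + \<beta>\<close> is at least 1, so its kernel is bounded on bounded sets and Fubini's theorem
  applies at every \<open>t\<close>, not merely at almost every \<open>t\<close>.
\<close>
lemma frac_conv_semigroup:
  fixes \<phi> :: "real \<Rightarrow> real"
  assumes \<alpha>\<beta>: "0 < \<alpha>" "0 < \<beta>" "1 \<le> \<alpha> + \<beta>"
    and \<phi>: "integrable lborel \<phi>" and supp: "\<And>s. s < a \<Longrightarrow> \<phi> s = 0"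
  shows "integrable lborel (\<lambda>\<tau>. frac_kernel \<alpha> (t - \<tau>) * frac_conv \<beta> \<phi> \<tau>)"
    and "(LINT \<tau>|lborel. frac_kernel \<alpha> (t - \<tau>) * frac_conv \<beta> \<phi> \<tau>) = frac_conv (\<alpha> + \<beta>) \<phi> t"
    and "AE \<tau> in lborel. \<tau> < t \<longrightarrow> integrable lborel (\<lambda>s. frac_kernel \<beta> (\<tau> - s) * \<phi> s)"
proof -
  have [measurable]: "\<phi> \<in> borel_measurable borel" using borel_measurable_integrable[OF \<phi>] by simp
  let ?f = "\<lambda>\<tau> s. frac_kernel \<alpha> (t - \<tau>) * (frac_kernel \<beta> (\<tau> - s) * \<phi> s)"
  let ?K = "frac_kernel (\<alpha> + \<beta>) (t - a)"
  have K: "frac_kernel (\<alpha> + \<beta>) (t - s) * \<bar>\<phi> s\<bar> \<le> ?K * \<bar>\<phi> s\<bar>" for s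
    using supp[of s] frac_kernel_le[OF \<alpha>\<beta>(3), of "t - s" "t - a"] by (cases "s < a") (auto intro: mult_right_mono)
  have int: "integrable (lborel \<Otimes>\<^sub>M lborel) (\<lambda>(\<tau>, s). ?f \<tau> s)"
  proof (rule integrableI_bounded)
    have "(\<integral>\<^sup>+p. ennreal (norm ((\<lambda>(\<tau>, s). ?f \<tau> s) p)) \<partial>(lborel \<Otimes>\<^sub>M lborel))
       = (\<integral>\<^sup>+s. \<integral>\<^sup>+\<tau>. ennreal (norm (?f \<tau> s)) \<partial>lborel \<partial>lborel)"
      by (subst lborel_pair.nn_integral_snd[symmetric]) (auto simp: case_prod_unfold)
    also have "\<dots> = (\<integral>\<^sup>+s. ennreal (frac_kernel (\<alpha> + \<beta>) (t - s) * \<bar>\<phi> s\<bar>) \<partial>lborel)"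
    proof (rule nn_integral_cong)
      fix s
      have "(\<integral>\<^sup>+\<tau>. ennreal (norm (?f \<tau> s)) \<partial>lborel)
         = (\<integral>\<^sup>+\<tau>. ennreal (frac_kernel \<alpha> (t - \<tau>) * frac_kernel \<beta> (\<tau> - s)) * ennreal \<bar>\<phi> s\<bar> \<partial>lborel)"
        using \<alpha>\<beta> by (intro nn_integral_cong)
          (simp add: abs_mult frac_kernel_nonneg ennreal_mult''[symmetric] mult.assoc)
      also have "\<dots> = ennreal (frac_kernel (\<alpha> + \<beta>) (t - s)) * ennreal \<bar>\<phi> s\<bar>"
        by (subst nn_integral_multc) (auto simp: nn_integral_frac_kernel_convolution[OF \<alpha>\<beta>(1,2)])
      finally show "(\<integral>\<^sup>+\<tau>. ennreal (norm (?f \<tau> s)) \<partial>lborel) = ennreal (frac_kernel (\<alpha> + \<beta>) (t - s) * \<bar>\<phi> s\<bar>)"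
        by (simp add: ennreal_mult'')
    qed
    also have "\<dots> \<le> (\<integral>\<^sup>+s. ennreal (norm (?K * \<phi> s)) \<partial>lborel)"
      using K \<alpha>\<beta> by (intro nn_integral_mono ennreal_leI) (simp add: abs_mult frac_kernel_nonneg)
    also have "\<dots> < \<infinity>"
      using integrable_mult_right[OF \<phi>, of ?K] by (simp only: integrable_iff_bounded)
    finally show "(\<integral>\<^sup>+p. ennreal (norm ((\<lambda>(\<tau>, s). ?f \<tau> s) p)) \<partial>(lborel \<Otimes>\<^sub>M lborel)) < \<infinity>" .
  qed measurable
  have inner: "(LINT s|lborel. ?f \<tau> s) = frac_kernel \<alpha> (t - \<tau>) * frac_conv \<beta> \<phi> \<tau>" for \<tau>
    by (simp add: frac_conv_def)
  show "integrable lborel (\<lambda>\<tau>. frac_kernel \<alpha> (t - \<tau>) * frac_conv \<beta> \<phi> \<tau>)"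
    using lborel_pair.integrable_fst[OF int] by (simp only: inner)
  have "(LINT \<tau>|lborel. frac_kernel \<alpha> (t - \<tau>) * frac_conv \<beta> \<phi> \<tau>) = (LINT s|lborel. LINT \<tau>|lborel. ?f \<tau> s)"
    using lborel_pair.Fubini_integral[OF int] by (simp only: inner)
  also have "\<dots> = frac_conv (\<alpha> + \<beta>) \<phi> t"
    unfolding frac_conv_def mult.assoc[symmetric]
    by (simp add: frac_kernel_convolution(2)[OF \<alpha>\<beta>(1,2)])
  finally show "(LINT \<tau>|lborel. frac_kernel \<alpha> (t - \<tau>) * frac_conv \<beta> \<phi> \<tau>) = frac_conv (\<alpha> + \<beta>) \<phi> t" .
  show "AE \<tau> in lborel. \<tau> < t \<longrightarrow> integrable lborel (\<lambda>s. frac_kernel \<beta> (\<tau> - s) * \<phi> s)"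
    using lborel_pair.AE_integrable_fst[OF int]
  proof (rule AE_mp, intro AE_I2 impI)
    fix \<tau> assume int\<tau>: "integrable lborel (?f \<tau>)" and "\<tau> < t"
    \<comment> \<open>The outer kernel does not depend on \<open>s\<close> and can be cancelled
      where it is nonzero; this is why the claim is restricted to \<tau> < t.\<close>
    have "frac_kernel \<alpha> (t - \<tau>) \<noteq> 0" using \<open>\<tau> < t\<close> Gamma_real_pos[OF \<alpha>\<beta>(1)] by (simp add: frac_kernel_def)
    with int\<tau> show "integrable lborel (\<lambda>s. frac_kernel \<beta> (\<tau> - s) * \<phi> s)"
      by (simp add: integrable_mult_right_iff)
  qed
qed

text \<open>Supplies the Borel functions that Fubini's theorem on the product of
  \<open>lborel\<close> with itself needs, while \<open>q\<close> is only Lebesgue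
  measurable.\<close>

lemma absolutely_integrable_borel_representative:
  fixes q :: "real \<Rightarrow> real"
  assumes q: "q absolutely_integrable_on {a..b}"
  obtains \<phi> where "integrable lborel \<phi>" "\<And>s. s \<notin> {a..b} \<Longrightarrow> \<phi> s = 0"
    "AE s in lebesgue. s \<in> {a..b} \<longrightarrow> q s = \<phi> s"
proof -
  let ?q = "\<lambda>s. indicator {a..b} s *\<^sub>R q s"
  have int: "integrable lebesgue ?q" using q by (simp add: set_integrable_def)
  obtain \<psi> where \<psi>: "\<psi> \<in> borel_measurable lborel" "AE s in lborel. ?q s = \<psi> s"
    using completion_ex_borel_measurable_real[OF borel_measurable_integrable[OF int]] by blast
  let ?\<phi> = "\<lambda>s. indicator {a..b} s * \<psi> s"
  have meas: "?\<phi> \<in> borel_measurable lborel" using \<psi>(1) by measurable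
  have AE: "AE s in lebesgue. ?q s = \<psi> s" using \<psi>(2) by (rule AE_completion)
  then have AE': "AE s in lebesgue. ?q s = ?\<phi> s" by eventually_elim (auto split: split_indicator)
  show thesis
  proof
    have "integrable lebesgue ?\<phi>"
      by (rule integrable_cong_AE_imp[OF int measurable_completion[OF meas] AE'])
    then show "integrable lborel ?\<phi>" using integrable_completion[OF meas] by simp
    show "AE s in lebesgue. s \<in> {a..b} \<longrightarrow> q s = ?\<phi> s"
      using AE' by eventually_elim auto
  qed auto
qed

text \<open>The two integrands agree almost everywhere, so the equality holds at every t \<le> b
  without integrability: where that fails, both integrals are 0 by convention. Order 0 is excluded,
  since there \<open>RL_integral_raw\<close> is \<open>q\<close> itself.\<close>

lemma RL_integral_raw_eq_frac_conv:
  fixes q :: "real \<Rightarrow> real"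
  assumes q: "q absolutely_integrable_on {a..b}"
    and \<phi>: "\<phi> \<in> borel_measurable borel" "\<And>s. s \<notin> {a..b} \<Longrightarrow> \<phi> s = 0"
    "AE s in lebesgue. s \<in> {a..b} \<longrightarrow> q s = \<phi> s"
    and "t \<le> b"
  shows "\<alpha> \<noteq> 0 \<Longrightarrow> RL_integral_raw a \<alpha> q t = frac_conv \<alpha> \<phi> t"
    and "integrable lborel (\<lambda>s. frac_kernel \<alpha> (t - s) * \<phi> s) \<Longrightarrow>
      set_integrable lebesgue {a..t} (\<lambda>\<tau>. (1 / Gamma \<alpha> * (t - \<tau>) powr (\<alpha> - 1)) * q \<tau>)"
proof -
  let ?l = "\<lambda>\<tau>. indicator {a..t} \<tau> *\<^sub>R ((1 / Gamma \<alpha> * (t - \<tau>) powr (\<alpha> - 1)) * q \<tau>)"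
  let ?r = "\<lambda>\<tau>. frac_kernel \<alpha> (t - \<tau>) * \<phi> \<tau>"
  have "(\<lambda>\<tau>. indicator {a..b} \<tau> *\<^sub>R q \<tau>) \<in> borel_measurable lebesgue"
    using q by (simp add: set_integrable_def borel_measurable_integrable)
  then have "(\<lambda>\<tau>. (indicator {a..t} \<tau> * (1 / Gamma \<alpha> * (t - \<tau>) powr (\<alpha> - 1))) * (indicator {a..b} \<tau> *\<^sub>R q \<tau>))
     \<in> borel_measurable lebesgue"
    by (rule borel_measurable_times[rotated]) (rule measurable_completion, measurable)
  moreover have "(\<lambda>\<tau>. (indicator {a..t} \<tau> * (1 / Gamma \<alpha> * (t - \<tau>) powr (\<alpha> - 1))) * (indicator {a..b} \<tau> *\<^sub>R q \<tau>)) = ?l"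
    using \<open>t \<le> b\<close> by (auto simp: indicator_def fun_eq_iff)
  ultimately have ml: "?l \<in> borel_measurable lebesgue" by simp
  have mr: "?r \<in> borel_measurable lborel" using \<phi>(1) by measurable
  then have mr': "?r \<in> borel_measurable lebesgue" by (rule measurable_completion)
  have eq: "AE \<tau> in lebesgue. ?l \<tau> = ?r \<tau>"
    using \<phi>(3)
  proof (eventually_elim)
    case (elim \<tau>)
    then show ?case using \<phi>(2)[of \<tau>] \<open>t \<le> b\<close> by (auto simp: indicator_def frac_kernel_def)
  qed
  show "RL_integral_raw a \<alpha> q t = frac_conv \<alpha> \<phi> t" if "\<alpha> \<noteq> 0"
    using that integral_cong_AE[OF ml mr' eq] integral_completion[OF mr]
    by (simp add: RL_integral_raw_def set_lebesgue_integral_def frac_conv_def)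
  assume "integrable lborel ?r"
  then have "integrable lebesgue ?r" using integrable_completion[OF mr] by simp
  then show "set_integrable lebesgue {a..t} (\<lambda>\<tau>. (1 / Gamma \<alpha> * (t - \<tau>) powr (\<alpha> - 1)) * q \<tau>)"
    unfolding set_integrable_def using integrable_cong_AE_imp[OF _ ml AE_symmetric[OF eq]] by blast
qed

section \<open>Inversion of the fractional integral equation\<close>

lemma AE_lebesgue_on_iff_lborel:
  assumes "S \<in> sets lebesgue"
  shows "(AE x in lebesgue_on S. P x) \<longleftrightarrow> (AE x in lborel. x \<in> S \<longrightarrow> P x)"
  using assms by (simp add: AE_restrict_space_iff AE_completion_iff)

text \<open>The primitive of \<open>D\<close> vanishes identically, and almost everywhere
  \<open>D\<close> is the derivative of its primitive.\<close>

lemma negligible_nonzero_if_integral_eq_0: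
  fixes D :: "real \<Rightarrow> real"
  assumes D: "\<And>t. t \<in> {a..b} \<Longrightarrow> (D has_integral 0) {a..t}"
  shows "negligible {t \<in> {a..b}. D t \<noteq> 0}"
proof (cases "a \<le> b")
  case True
  let ?N = "{t \<in> {a<..<b}. \<not> ((\<lambda>x. integral {a..x} D) has_real_derivative D t) (at t)}"
  have "negligible ?N"
    using D[of b] True by (intro negligible_not_has_derivative_integral) auto
  moreover have "{t \<in> {a..b}. D t \<noteq> 0} \<subseteq> ?N \<union> {a, b}"
  proof
    fix t assume t: "t \<in> {t \<in> {a..b}. D t \<noteq> 0}"
    show "t \<in> ?N \<union> {a, b}"
    proof (cases "t \<in> {a<..<b}")
      case True
      have "\<not> ((\<lambda>x. integral {a..x} D) has_real_derivative D t) (at t)"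
      proof
        assume "((\<lambda>x. integral {a..x} D) has_real_derivative D t) (at t)"
        then have "((\<lambda>x. 0) has_real_derivative D t) (at t)"
          by (rule has_field_derivative_transform_within_open[where S="{a<..<b}"])
            (use True D integral_unique in \<open>auto\<close>)
        then have "D t = 0" using DERIV_unique DERIV_const by blast
        then show False using t by simp
      qed
      then show ?thesis using True by simp
    qed (use t in auto)
  qed
  ultimately show ?thesis by (meson finite.intros negligible_Un negligible_finite negligible_subset)
qed simp

lemma frac_conv_eq_0:
  assumes "\<And>s. s < a \<Longrightarrow> \<phi> s = 0" "\<tau> \<le> a"
  shows "frac_conv \<beta> \<phi> \<tau> = 0"
proof -
  have "frac_kernel \<beta> (\<tau> - s) * \<phi> s = 0" for s using assms by (cases "s < a") auto
  then show ?thesis unfolding frac_conv_def by (simp only: integral_zero)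
qed

text \<open>\<open>frac_kernel 1\<close> is the Heaviside function with value 0 at 0, so the
  convolution integrates over \<open>{a..<t}\<close>; the missing endpoint is negligible.\<close>

lemma has_integral_frac_kernel_1:
  fixes h :: "real \<Rightarrow> real"
  assumes h: "integrable lborel (\<lambda>\<tau>. frac_kernel 1 (t - \<tau>) * h \<tau>)" and supp: "\<And>\<tau>. \<tau> < a \<Longrightarrow> h \<tau> = 0"
  shows "(h has_integral (LINT \<tau>|lborel. frac_kernel 1 (t - \<tau>) * h \<tau>)) {a..t}"
proof -
  have "(\<lambda>\<tau>. frac_kernel 1 (t - \<tau>) * h \<tau>) = (\<lambda>\<tau>. if \<tau> \<in> {a..<t} then h \<tau> else 0)"
    using supp by (auto simp: frac_kernel_1 fun_eq_iff)
  then have "(h has_integral (LINT \<tau>|lborel. frac_kernel 1 (t - \<tau>) * h \<tau>)) {a..<t}"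
    using has_integral_integral_lborel[OF h] by (simp only: has_integral_restrict_UNIV)
  then show ?thesis
    by (rule has_integral_spike_set_eq[THEN iffD1, rotated -1]) (auto intro: negligible_subset[of "{t}"])
qed

text \<open>
  Apply the fractional integral of order \<open>\<alpha>\<close> to the left equation and that of order
  \<open>1 - \<alpha>\<close> to the right one.
\<close>
lemma frac_conv_inversion:
  fixes \<phi> \<gamma> :: "real \<Rightarrow> real"
  assumes \<alpha>: "0 < \<alpha>" "\<alpha> < 1"
    and \<phi>: "integrable lborel \<phi>" "\<And>s. s < a \<Longrightarrow> \<phi> s = 0"
    and \<gamma>: "integrable lborel \<gamma>" "\<And>s. s < a \<Longrightarrow> \<gamma> s = 0"
  shows "(AE t in lborel. t \<in> {a..b} \<longrightarrow> frac_conv (1 - \<alpha>) \<phi> t = c + frac_conv 1 \<gamma> t) \<longleftrightarrow>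
    (AE t in lborel. t \<in> {a..b} \<longrightarrow> \<phi> t = c * frac_kernel \<alpha> (t - a) + frac_conv \<alpha> \<gamma> t)"
    (is "?L \<longleftrightarrow> ?R")
proof -
  define \<psi> where "\<psi> \<tau> = c * frac_kernel \<alpha> (\<tau> - a) + frac_conv \<alpha> \<gamma> \<tau>" for \<tau>
  \<comment> \<open>A fractional integral adds its order to both orders in a right-hand side of this
    shape. With \<beta>' = 1 it is the left equation, as \<open>frac_kernel 1 (\<tau> - a)\<close>
    is 1 for \<tau> > a; with \<beta>' = \<alpha> it is the right one.\<close>
  have kernel: "integrable lborel (\<lambda>\<tau>. frac_kernel \<beta> (t - \<tau>) * (c * frac_kernel \<beta>' (\<tau> - a) + frac_conv \<beta>' \<gamma> \<tau>))"
     "(LINT \<tau>|lborel. frac_kernel \<beta> (t - \<tau>) * (c * frac_kernel \<beta>' (\<tau> - a) + frac_conv \<beta>' \<gamma> \<tau>))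
      = c * frac_kernel (\<beta> + \<beta>') (t - a) + frac_conv (\<beta> + \<beta>') \<gamma> t"
    if "0 < \<beta>" "0 < \<beta>'" "1 \<le> \<beta> + \<beta>'" for \<beta> \<beta>' t
  proof -
    have eq: "frac_kernel \<beta> (t - \<tau>) * (c * frac_kernel \<beta>' (\<tau> - a) + frac_conv \<beta>' \<gamma> \<tau>)
       = c * (frac_kernel \<beta> (t - \<tau>) * frac_kernel \<beta>' (\<tau> - a)) + frac_kernel \<beta> (t - \<tau>) * frac_conv \<beta>' \<gamma> \<tau>" for \<tau>
      by (simp add: algebra_simps)
    note k = frac_kernel_convolution[OF that(1,2), of t a] and s = frac_conv_semigroup[OF that \<gamma>, where t=t]
    show "integrable lborel (\<lambda>\<tau>. frac_kernel \<beta> (t - \<tau>) * (c * frac_kernel \<beta>' (\<tau> - a) + frac_conv \<beta>' \<gamma> \<tau>))"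
      unfolding eq using k(1) s(1) by simp
    show "(LINT \<tau>|lborel. frac_kernel \<beta> (t - \<tau>) * (c * frac_kernel \<beta>' (\<tau> - a) + frac_conv \<beta>' \<gamma> \<tau>))
      = c * frac_kernel (\<beta> + \<beta>') (t - a) + frac_conv (\<beta> + \<beta>') \<gamma> t"
      unfolding eq using k s by simp
  qed
  \<comment> \<open>At t = a the kernel of order 1 is 0 instead of 1.\<close>
  have not_a: "AE t in lborel. t \<noteq> a" by (rule AE_lborel_singleton)
  show ?thesis
  proof
    assume L: ?L
    \<comment> \<open>The primitives of \<open>\<phi>\<close> and \<open>\<psi>\<close> are compared
      at every t \<le> b, not merely almost everywhere; only then can they be
      differentiated.\<close>
    have int0: "integrable lborel (\<lambda>\<tau>. frac_kernel 1 (t - \<tau>) * (\<phi> \<tau> - \<psi> \<tau>)) \<and>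
        (LINT \<tau>|lborel. frac_kernel 1 (t - \<tau>) * (\<phi> \<tau> - \<psi> \<tau>)) = 0" if t: "t \<le> b" for t
    proof -
      have \<alpha>': "0 < \<alpha>" "0 < 1 - \<alpha>" "1 \<le> \<alpha> + (1 - \<alpha>)" using \<alpha> by auto
      have i1: "integrable lborel (\<lambda>\<tau>. frac_kernel 1 (t - \<tau>) * \<phi> \<tau>)"
      proof (rule Bochner_Integration.integrable_bound[OF \<phi>(1)])
        show "(\<lambda>\<tau>. frac_kernel 1 (t - \<tau>) * \<phi> \<tau>) \<in> borel_measurable lborel"
          using borel_measurable_integrable[OF \<phi>(1)] by measurable
      qed (auto simp: frac_kernel_1 indicator_def)
      have i2: "integrable lborel (\<lambda>\<tau>. frac_kernel 1 (t - \<tau>) * \<psi> \<tau>)"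
        unfolding \<psi>_def using \<alpha> by (intro kernel(1)) auto
      have "(LINT \<tau>|lborel. frac_kernel 1 (t - \<tau>) * \<phi> \<tau>) = frac_conv (\<alpha> + (1 - \<alpha>)) \<phi> t"
        by (simp add: frac_conv_def)
      also have "\<dots> = (LINT \<tau>|lborel. frac_kernel \<alpha> (t - \<tau>) * frac_conv (1 - \<alpha>) \<phi> \<tau>)"
        using frac_conv_semigroup(2)[OF \<alpha>' \<phi>, where t=t] by simp
      also have "\<dots> = (LINT \<tau>|lborel. frac_kernel \<alpha> (t - \<tau>) * (c * frac_kernel 1 (\<tau> - a) + frac_conv 1 \<gamma> \<tau>))"
      proof (rule integral_cong_AE)
        show "AE \<tau> in lborel. frac_kernel \<alpha> (t - \<tau>) * frac_conv (1 - \<alpha>) \<phi> \<tau>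
           = frac_kernel \<alpha> (t - \<tau>) * (c * frac_kernel 1 (\<tau> - a) + frac_conv 1 \<gamma> \<tau>)"
          using L not_a
        proof eventually_elim
          case (elim \<tau>)
          consider "\<tau> < a" | "a < \<tau>" "\<tau> < t" | "t \<le> \<tau>" using elim(2) by linarith
          then show ?case
          proof cases
            case 1
            then have "frac_conv (1 - \<alpha>) \<phi> \<tau> = 0" "frac_conv 1 \<gamma> \<tau> = 0"
              using frac_conv_eq_0[of a] \<phi>(2) \<gamma>(2) by (auto simp: less_imp_le)
            then show ?thesis using 1 by simp
          next
            case 2
            then show ?thesis using elim(1) t by (simp add: frac_kernel_1)
          qed simp
        qed
      qed (use frac_conv_semigroup(1)[OF \<alpha>' \<phi>, where t=t] kernel(1)[OF \<alpha>(1) zero_less_one, of t] \<alpha> in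
          \<open>auto dest: borel_measurable_integrable\<close>)
      also have "\<dots> = c * frac_kernel (\<alpha> + 1) (t - a) + frac_conv (\<alpha> + 1) \<gamma> t"
        using \<alpha> by (intro kernel(2)) auto
      \<comment> \<open>The total order \<alpha> + 1 is now read as order 1 applied after order
        \<alpha>, which is the primitive of \<open>\<psi>\<close>.\<close>
      also have "\<dots> = (LINT \<tau>|lborel. frac_kernel 1 (t - \<tau>) * \<psi> \<tau>)"
        unfolding \<psi>_def using \<alpha> by (subst kernel(2)) (auto simp: add.commute)
      finally show ?thesis using i1 i2 by (simp add: right_diff_distrib)
    qed
    have "((\<lambda>\<tau>. \<phi> \<tau> - \<psi> \<tau>) has_integral 0) {a..t}" if t: "t \<in> {a..b}" for t
    proof -
      have "\<phi> \<tau> - \<psi> \<tau> = 0" if "\<tau> < a" for \<tau>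
        using frac_conv_eq_0[of a \<gamma> \<tau> \<alpha>] \<phi>(2)[of \<tau>] \<gamma>(2) that by (simp add: \<psi>_def)
      then show ?thesis
        using has_integral_frac_kernel_1[of t "\<lambda>\<tau>. \<phi> \<tau> - \<psi> \<tau>" a] int0[of t] t by simp
    qed
    then have "negligible {t \<in> {a..b}. \<phi> t - \<psi> t \<noteq> 0}"
      by (rule negligible_nonzero_if_integral_eq_0)
    then have "AE t in lebesgue_on {a..b}. \<phi> t = \<psi> t"
      by (simp add: AE_lebesgue_on_iff_negligible)
    then show ?R by (simp add: AE_lebesgue_on_iff_lborel \<psi>_def)
  next
    assume R: ?R
    have \<alpha>': "0 < 1 - \<alpha>" "0 < \<alpha>" "1 \<le> (1 - \<alpha>) + \<alpha>" using \<alpha> by auto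
    have "frac_conv (1 - \<alpha>) \<phi> t = c + frac_conv 1 \<gamma> t" if t: "a < t" "t \<le> b" for t
    proof -
      have "frac_conv (1 - \<alpha>) \<phi> t = (LINT \<tau>|lborel. frac_kernel (1 - \<alpha>) (t - \<tau>) * \<psi> \<tau>)"
        unfolding frac_conv_def
      proof (rule integral_cong_AE)
        show "AE \<tau> in lborel. frac_kernel (1 - \<alpha>) (t - \<tau>) * \<phi> \<tau> = frac_kernel (1 - \<alpha>) (t - \<tau>) * \<psi> \<tau>"
          using R
        proof eventually_elim
          case (elim \<tau>)
          consider "\<tau> < a" | "a \<le> \<tau>" "\<tau> < t" | "t \<le> \<tau>" by linarith
          then show ?case
          proof cases
            case 1
            then have "frac_conv \<alpha> \<gamma> \<tau> = 0" using frac_conv_eq_0[of a] \<gamma>(2) by auto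
            then show ?thesis using 1 \<phi>(2) by (simp add: \<psi>_def)
          next
            case 2
            then show ?thesis using elim t by (simp add: \<psi>_def)
          qed simp
        qed
        show "(\<lambda>\<tau>. frac_kernel (1 - \<alpha>) (t - \<tau>) * \<phi> \<tau>) \<in> borel_measurable lborel"
          using borel_measurable_integrable[OF \<phi>(1)] by measurable
        show "(\<lambda>\<tau>. frac_kernel (1 - \<alpha>) (t - \<tau>) * \<psi> \<tau>) \<in> borel_measurable lborel"
          using kernel(1)[OF \<alpha>', of t] unfolding \<psi>_def by (rule borel_measurable_integrable)
      qed
      also have "\<dots> = c * frac_kernel 1 (t - a) + frac_conv 1 \<gamma> t"
        using kernel(2)[OF \<alpha>', of t] by (simp add: \<psi>_def)
      finally show ?thesis using t by (simp add: frac_kernel_1)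
    qed
    with not_a show ?L by (auto elim!: eventually_mono)
  qed
qed

section \<open>Continuous representatives and primitives on an interval\<close>

lemma left_intervalsD:
  assumes "I \<in> left_intervals a"
  shows "is_interval I" "a \<in> I" "I \<subseteq> {a..}" "I \<in> sets lebesgue"
    and "\<exists>b\<in>I. a < b" and "\<And>b. b \<in> I \<Longrightarrow> {a..b} \<subseteq> I"
proof -
  show *: "is_interval I" "a \<in> I" "I \<subseteq> {a..}" using assms by (auto simp: left_intervals_def)
  show "I \<in> sets lebesgue" using real_interval_borel_measurable[OF *(1)] by (simp add: sets_completionI_sets)
  obtain b where "b \<in> I" "b \<noteq> a" using assms by (auto simp: left_intervals_def)
  then show "\<exists>b\<in>I. a < b" using *(3) by force
  show "{a..b} \<subseteq> I" if "b \<in> I" for b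
    using mem_is_interval_1_I[OF *(1,2) that] by auto
qed

text \<open>Negligibility is a local property. The lemma is needed because local integrability
  controls a function only on compact intervals, and \<open>I\<close> itself need not be
  compact.\<close>

lemma AE_left_interval_iff:
  assumes I: "I \<in> left_intervals a"
  shows "(AE t in lebesgue_on I. P t) \<longleftrightarrow> (\<forall>b\<in>I. a < b \<longrightarrow> (AE t in lebesgue_on {a..b}. P t))"
proof -
  note ID = left_intervalsD[OF I]
  have "negligible {t \<in> I. \<not> P t} \<longleftrightarrow> (\<forall>b\<in>I. a < b \<longrightarrow> negligible {t \<in> {a..b}. \<not> P t})"
  proof (intro iffI ballI impI)
    fix b assume N: "negligible {t \<in> I. \<not> P t}" and "b \<in> I"
    show "negligible {t \<in> {a..b}. \<not> P t}"
      by (rule negligible_subset[OF N]) (use ID(6)[OF \<open>b \<in> I\<close>] in blast)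
  next
    assume N: "\<forall>b\<in>I. a < b \<longrightarrow> negligible {t \<in> {a..b}. \<not> P t}"
    show "negligible {t \<in> I. \<not> P t}"
    proof (rule locally_negligible_alt[THEN iffD2], rule ballI)
      fix x assume x: "x \<in> {t \<in> I. \<not> P t}"
      \<comment> \<open>If \<open>x\<close> is not the largest element of \<open>I\<close>,
        \<open>b\<close> is chosen beyond it; otherwise \<open>b\<close> is \<open>x\<close>. Either
        way \<open>{a..b}\<close> is a neighbourhood of \<open>x\<close> relative to
        \<open>I\<close>.\<close>
      obtain b where b: "b \<in> I" "a < b" "x \<le> b" "x < b \<or> (\<forall>y\<in>I. y \<le> b)"
      proof (cases "\<exists>y\<in>I. x < y")
        case True
        then obtain y where "y \<in> I" "x < y" by blast
        then show ?thesis using x ID(3) by (intro that[of y]) force+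
      next
        case False
        then have "\<forall>y\<in>I. y \<le> x" by force
        then show ?thesis using x ID(5) by (intro that[of x]) force+
      qed
      let ?V = "if x < b then {..<b} else UNIV"
      have "open ?V" by auto
      then have "openin (top_of_set {t \<in> I. \<not> P t}) ({t \<in> I. \<not> P t} \<inter> ?V)" by (rule openin_open_Int)
      moreover have "negligible ({t \<in> I. \<not> P t} \<inter> ?V)"
      proof (rule negligible_subset)
        show "negligible {t \<in> {a..b}. \<not> P t}" using N b(1,2) by blast
        have "t \<in> {a..b}" if "t \<in> I" "t \<in> ?V" for t
          using that b(4) ID(3) by (cases "x < b") force+
        then show "{t \<in> I. \<not> P t} \<inter> ?V \<subseteq> {t \<in> {a..b}. \<not> P t}" by blast
      qed
      moreover have "x \<in> {t \<in> I. \<not> P t} \<inter> ?V" using x by auto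
      ultimately show "\<exists>U. openin (top_of_set {t \<in> I. \<not> P t}) U \<and> x \<in> U \<and> negligible U" by blast
    qed
  qed
  then show ?thesis using ID(4) by (simp add: AE_lebesgue_on_iff_negligible)
qed

text \<open>By continuity, functions that differ at \<open>t\<close> differ on a whole interval next
  to \<open>t\<close>, which is not negligible.\<close>

lemma AE_eq_imp_eq_continuous_on:
  fixes F G :: "real \<Rightarrow> real"
  assumes I: "I \<in> left_intervals a" and F: "continuous_on I F" and G: "continuous_on I G"
    and eq: "AE t in lebesgue_on I. F t = G t" and t: "t \<in> I"
  shows "F t = G t"
proof (rule ccontr)
  assume ne: "F t \<noteq> G t"
  note ID = left_intervalsD[OF I]
  let ?N = "{s \<in> I. F s \<noteq> G s}"
  have neg: "negligible ?N" using eq ID(4) by (simp add: AE_lebesgue_on_iff_negligible)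
  have "continuous_on I (\<lambda>s. F s - G s)" by (intro continuous_intros F G)
  then obtain d where d: "d > 0" "\<And>s. s \<in> I \<Longrightarrow> dist s t < d \<Longrightarrow> dist (F s - G s) (F t - G t) < \<bar>F t - G t\<bar>"
    using ne t unfolding continuous_on_iff by (metis right_minus_eq zero_less_abs_iff)
  obtain y where y: "y \<in> I" "y \<noteq> t" using ID(2,5) by (metis order_less_irrefl)
  have *: "s \<in> ?N" if "s \<in> I" "dist s t < d" for s
    using d(2)[OF that] that(1) by (auto simp: dist_real_def)
  \<comment> \<open>\<open>t\<close> may be an endpoint of \<open>I\<close>, so the interval is
    taken on the side of another point \<open>y\<close> of \<open>I\<close>.\<close>
  let ?B = "if t < y then {t<..<min y (t + d)} else {max y (t - d)<..<t}"
  have "?B \<subseteq> ?N"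
  proof
    fix s assume s: "s \<in> ?B"
    then have "s \<in> I" using y t ID(1) unfolding is_interval_1
      by (smt (verit) greaterThanLessThan_iff)
    moreover have "dist s t < d" using s by (auto simp: dist_real_def split: if_splits)
    ultimately show "s \<in> ?N" by (rule *)
  qed
  then have "negligible ?B" using neg negligible_subset by blast
  moreover have "open ?B" "?B \<noteq> {}" using y d by auto
  ultimately show False using open_not_negligible by blast
qed

lemma cont_rep_AE: "AE t in lebesgue_on I. cont_rep I g t = g t"
proof (cases "\<exists>F. continuous_on I F \<and> (AE t in lebesgue_on I. g t = F t)")
  case True
  then have "AE t in lebesgue_on I. g t = cont_rep I g t"
    unfolding cont_rep_def using someI_ex[OF True] by simp
  then show ?thesis by eventually_elim simp
next
  case False
  then have "cont_rep I g = g" unfolding cont_rep_def by (simp only: if_False)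
  then show ?thesis by simp
qed

lemma cont_rep_eq:
  assumes I: "I \<in> left_intervals a" and F: "continuous_on I F" "AE t in lebesgue_on I. g t = F t" and t: "t \<in> I"
  shows "cont_rep I g t = F t"
proof (rule AE_eq_imp_eq_continuous_on[OF I _ F(1) _ t])
  have ex: "\<exists>F. continuous_on I F \<and> (AE t in lebesgue_on I. g t = F t)" using F by blast
  then show "continuous_on I (cont_rep I g)"
    unfolding cont_rep_def using someI_ex[OF ex] by simp
  show "AE t in lebesgue_on I. cont_rep I g t = F t"
    using cont_rep_AE[of I g] F(2) by eventually_elim simp
qed

lemma AC_loc_cong:
  assumes "\<And>t. t \<in> I \<Longrightarrow> F t = G t"
  shows "F \<in> AC_loc I \<longleftrightarrow> G \<in> AC_loc I"
proof -
  have *: "AC_on {c..d} F" if "AC_on {c..d} G" "\<And>t. t \<in> {c..d} \<Longrightarrow> F t = G t" for c d and F G :: "real \<Rightarrow> real"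
  proof -
    have eq: "(\<Sum>k\<in>D. \<bar>F (Sup k) - F (Inf k)\<bar>) = (\<Sum>k\<in>D. \<bar>G (Sup k) - G (Inf k)\<bar>)"
      if "D division_of T" "T \<subseteq> {c..d}" for D T
      using division_interval_family(1)[OF that] \<open>\<And>t. t \<in> {c..d} \<Longrightarrow> F t = G t\<close>
      by (intro sum.cong) (fastforce simp: interval_family_def)+
    then show ?thesis using \<open>AC_on {c..d} G\<close> unfolding AC_on_def by (metis (no_types, lifting))
  qed
  show ?thesis
    unfolding AC_loc_def mem_Collect_eq using *[of _ _ F G] *[of _ _ G F] assms by (metis subsetD)
qed

lemma AC_loc_imp_continuous_on:
  assumes I: "I \<in> left_intervals a" and F: "F \<in> AC_loc I"
  shows "continuous_on I F"
  unfolding continuous_on_eq_continuous_within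
proof
  fix t assume t: "t \<in> I"
  note ID = left_intervalsD[OF I]
  have *: "continuous (at t within {a..b}) F" if "b \<in> I" "t \<le> b" for b
    using AC_on_imp_continuous_on[of a b F] F ID(3,6) that t
    by (auto simp: AC_loc_def continuous_on_eq_continuous_within)
  show "continuous (at t within I) F"
  proof (cases "\<exists>b\<in>I. t < b")
    case True
    then obtain b where b: "b \<in> I" "t < b" by blast
    have "at t within I = at t within {a..b}"
      using b ID(3) ID(6)[OF b(1)] by (intro at_within_nhd[of t "{..<b}"]) auto
    then show ?thesis using *[of b] b by simp
  next
    case False
    then have "I = {a..t}" using t ID(3) ID(6)[OF t] by force
    then show ?thesis using *[of t] t by simp
  qed
qed

lemma AC_loc_primitive:
  assumes I: "I \<in> left_intervals a" and g: "g \<in> L1_loc I"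
  shows "(\<lambda>t. c + integral {a..t} g) \<in> AC_loc I"
  unfolding AC_loc_def
proof (intro CollectI allI impI)
  fix x y assume xy: "{x..y} \<subseteq> I"
  note ID = left_intervalsD[OF I]
  show "AC_on {x..y} (\<lambda>t. c + integral {a..t} g)"
  proof (cases "x \<le> y")
    case True
    then have "x \<in> I" "y \<in> I" using xy by auto
    then have "g absolutely_integrable_on {a..y}" "{x..y} \<subseteq> {a..y}"
      using ID(3) ID(6) g by (auto simp: L1_loc_def)
    then have "AC_on {x..y} (\<lambda>t. integral {a..t} g)"
      using AC_on_indefinite_integral AC_on_subset by blast
    then show ?thesis by (simp add: AC_on_def)
  next
    case False
    then show ?thesis by (auto simp: AC_on_def intro!: exI[of _ 1])
  qed
qed

text \<open>
  No differentiability is presupposed on the left: \<^const>\<open>deriv\<close> is arbitrary where the derivative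
  does not exist, and its existence almost everywhere comes from absolute continuity.
\<close>
lemma cont_rep_primitive_iff:
  assumes I: "I \<in> left_intervals a" and g: "g \<in> L1_loc I"
  shows "(cont_rep I u \<in> AC_loc I \<and> cont_rep I u a = c \<and>
      (AE t in lebesgue_on I. deriv (cont_rep I u) t = g t)) \<longleftrightarrow>
    (AE t in lebesgue_on I. u t = c + integral {a..t} g)" (is "?L \<longleftrightarrow> ?R")
proof
  note ID = left_intervalsD[OF I]
  let ?F = "cont_rep I u"
  have g_int: "g absolutely_integrable_on {a..b}" "g integrable_on {a..b}" if "b \<in> I" for b
    using g ID(6)[OF that] by (auto simp: L1_loc_def set_lebesgue_integral_eq_integral)
  {
    assume L: ?L
    have "?F t = c + integral {a..t} g" if t: "t \<in> I" for t
    proof (cases "a < t")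
      case True
      have "AC_on {a..t} ?F" using L ID(6)[OF t] by (auto simp: AC_loc_def)
      then obtain h where h: "h absolutely_integrable_on {a..t}"
        "\<And>s. s \<in> {a..t} \<Longrightarrow> ?F s - ?F a = integral {a..s} h" using AC_on_integral True by blast
      \<comment> \<open>Outside \<open>?N\<close>, \<open>?M\<close> and the endpoints, the
        derivative of \<open>?F\<close> is \<open>h\<close> by the representation and
        \<open>g\<close> by hypothesis; hence the two integrands agree almost everywhere.\<close>
      let ?N = "{s \<in> {a<..<t}. \<not> ((\<lambda>x. integral {a..x} h) has_real_derivative h s) (at s)}"
      let ?M = "{s \<in> {a..t}. deriv ?F s \<noteq> g s}"
      have "negligible (?N \<union> ?M \<union> {a, t})"
      proof (intro negligible_Un)
        show "negligible ?N"
          using h(1) by (intro negligible_not_has_derivative_integral) (auto simp: set_lebesgue_integral_eq_integral)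
        show "negligible ?M"
          using L AE_left_interval_iff[OF I] t True by (auto simp: AE_lebesgue_on_iff_negligible)
      qed auto
      then have "integral {a..t} g = integral {a..t} h"
      proof (rule integral_spike)
        fix s assume s: "s \<in> {a..t} - (?N \<union> ?M \<union> {a, t})"
        then have s': "s \<in> {a<..<t}" by auto
        have "((\<lambda>x. integral {a..x} h) has_real_derivative h s) (at s)" using s s' by auto
        then have "((\<lambda>x. ?F a + integral {a..x} h) has_real_derivative h s) (at s)"
          by (auto intro!: derivative_eq_intros)
        then have "(?F has_real_derivative h s) (at s)"
        proof (rule has_field_derivative_transform_within_open[where S="{a<..<t}"])
          fix x assume "x \<in> {a<..<t}"
          then show "?F a + integral {a..x} h = ?F x" using h(2)[of x] by simp
        qed (use s' in auto)
        then show "h s = g s" using s s' DERIV_imp_deriv by fastforce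
      qed
      then show ?thesis using h(2)[of t] L True by simp
    next
      case False
      then have "t = a" using t ID(3) by force
      then show ?thesis using L by simp
    qed
    then have "AE t in lebesgue_on I. ?F t = c + integral {a..t} g" by (auto intro!: AE_I2)
    then show ?R using cont_rep_AE[of I u] by eventually_elim simp
  }
  {
    assume R: ?R
    let ?J = "\<lambda>t. c + integral {a..t} g"
    have J: "?J \<in> AC_loc I" by (rule AC_loc_primitive[OF I g])
    \<comment> \<open>\<open>?J\<close> is continuous and almost everywhere equal to
      \<open>u\<close>, so it is the representative at every point of \<open>I\<close>, in
      particular at \<open>a\<close>.\<close>
    have FJ: "?F t = ?J t" if "t \<in> I" for t
      by (rule cont_rep_eq[OF I AC_loc_imp_continuous_on[OF I J] R that])
    have "AE t in lebesgue_on I. deriv ?F t = g t"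
      unfolding AE_left_interval_iff[OF I]
    proof (intro ballI impI)
      fix b assume b: "b \<in> I" "a < b"
      let ?N = "{s \<in> {a<..<b}. \<not> ((\<lambda>x. integral {a..x} g) has_real_derivative g s) (at s)}"
      have "negligible ?N" using g_int[OF b(1)] by (intro negligible_not_has_derivative_integral)
      \<comment> \<open>The endpoints are discarded: a two-sided derivative at \<open>a\<close>
        involves points outside \<open>I\<close>, where the values of \<open>cont_rep\<close> are
        not determined.\<close>
      then have "negligible (?N \<union> {a, b})" by (intro negligible_Un) auto
      moreover have "{t \<in> {a..b}. deriv ?F t \<noteq> g t} \<subseteq> ?N \<union> {a, b}"
      proof
        fix s assume s: "s \<in> {t \<in> {a..b}. deriv ?F t \<noteq> g t}"
        show "s \<in> ?N \<union> {a, b}"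
        proof (rule ccontr)
          assume n: "s \<notin> ?N \<union> {a, b}"
          then have s': "s \<in> {a<..<b}" using s by auto
          with n have "((\<lambda>x. integral {a..x} g) has_real_derivative g s) (at s)" by blast
          then have "(?J has_real_derivative g s) (at s)" by (auto intro!: derivative_eq_intros)
          then have "(?F has_real_derivative g s) (at s)"
            by (rule has_field_derivative_transform_within_open[where S="{a<..<b}"])
              (use s' FJ[symmetric] ID(6)[OF b(1)] in \<open>auto simp: subset_iff\<close>)
          then show False using s DERIV_imp_deriv by fastforce
        qed
      qed
      ultimately have "negligible {t \<in> {a..b}. deriv ?F t \<noteq> g t}" by (rule negligible_subset)
      then show "AE t in lebesgue_on {a..b}. deriv ?F t = g t" by (simp add: AE_lebesgue_on_iff_negligible)
    qed
    then show ?L using FJ[OF ID(2)] J AC_loc_cong[of I ?F ?J] FJ by simp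
  }
qed

section \<open>Equivalence with the Volterra equation\<close>

lemma L1_locD: "q \<in> L1_loc I \<Longrightarrow> {c..d} \<subseteq> I \<Longrightarrow> q absolutely_integrable_on {c..d}"
  by (simp add: L1_loc_def)

lemma AE_left_interval_neq:
  assumes "I \<in> left_intervals a"
  shows "AE t in lebesgue_on I. a < t"
proof -
  have "AE t in lborel. t \<noteq> a" by (rule AE_lborel_singleton)
  then show ?thesis
    unfolding AE_lebesgue_on_iff_lborel[OF left_intervalsD(4)[OF assms]]
    by eventually_elim (use left_intervalsD(3)[OF assms] in force)
qed

text \<open>The kernel of order 1 is \<open>(t - \<tau>) powr 0\<close>, which is 0 rather than 1 at
  \<tau> = t; this single point does not change the integral.\<close>

lemma RL_integral_raw_1:
  fixes g :: "real \<Rightarrow> real"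
  assumes g: "g absolutely_integrable_on {a..b}" and t: "t \<le> b"
  shows "RL_integral_raw a 1 g t = integral {a..t} g"
proof -
  have "{a..t} \<subseteq> {a..b}" using t by auto
  then have gt: "g absolutely_integrable_on {a..t}" by (rule absolutely_integrable_on_subinterval[OF g])
  have "RL_integral_raw a 1 g t = (LINT \<tau>:{a..t}|lebesgue. g \<tau>)"
    unfolding RL_integral_raw_def set_lebesgue_integral_def
  proof (simp, rule integral_cong_AE)
    show m: "(\<lambda>\<tau>. indicator {a..t} \<tau> * g \<tau>) \<in> borel_measurable lebesgue"
      using gt by (auto simp: set_integrable_def dest: borel_measurable_integrable)
    have "(\<lambda>\<tau>. indicator {..<t} \<tau> * (indicator {a..t} \<tau> * g \<tau>)) \<in> borel_measurable lebesgue"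
      by (rule borel_measurable_times[OF _ m]) (rule measurable_completion, measurable)
    moreover have "(\<lambda>\<tau>. indicator {..<t} \<tau> * (indicator {a..t} \<tau> * g \<tau>))
        = (\<lambda>\<tau>. indicator {a..t} \<tau> * ((if t = \<tau> then 0 else 1) * g \<tau>))"
      by (auto simp: indicator_def fun_eq_iff)
    ultimately show "(\<lambda>\<tau>. indicator {a..t} \<tau> * ((if t = \<tau> then 0 else 1) * g \<tau>)) \<in> borel_measurable lebesgue"
      by simp
    have "AE \<tau> in lebesgue. \<tau> \<noteq> t" by (rule AE_completion[OF AE_lborel_singleton])
    then show "AE \<tau> in lebesgue. indicator {a..t} \<tau> * ((if t = \<tau> then 0 else 1) * g \<tau>) = indicator {a..t} \<tau> * g \<tau>"
      by eventually_elim auto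
  qed
  also have "\<dots> = integral {a..t} g" using gt by (rule set_lebesgue_integral_eq_integral(2))
  finally show ?thesis .
qed

text \<open>For \<alpha> < 1, Borel representatives on each \<open>{a..b}\<close> reduce the claim
  to \<open>frac_conv_inversion\<close>.\<close>

lemma RL_integral_raw_Abel_iff:
  assumes I: "I \<in> left_intervals a" and \<alpha>: "0 < \<alpha>" "\<alpha> \<le> 1"
    and q: "q \<in> L1_loc I" and g: "g \<in> L1_loc I"
  shows "(AE t in lebesgue_on I. RL_integral_raw a (1 - \<alpha>) q t = c + integral {a..t} g) \<longleftrightarrow>
    (AE t in lebesgue_on I. q t = c * frac_kernel \<alpha> (t - a) + RL_integral_raw a \<alpha> g t)"
proof -
  note ID = left_intervalsD[OF I]
  have lebesgue_Icc: "{x..y} \<in> sets lebesgue" for x y :: real by simp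
  have "(AE t in lebesgue_on {a..b}. RL_integral_raw a (1 - \<alpha>) q t = c + integral {a..t} g) \<longleftrightarrow>
    (AE t in lebesgue_on {a..b}. q t = c * frac_kernel \<alpha> (t - a) + RL_integral_raw a \<alpha> g t)"
    if b: "b \<in> I" for b
  proof -
    have ab: "q absolutely_integrable_on {a..b}" "g absolutely_integrable_on {a..b}"
      using L1_locD[OF q ID(6)[OF b]] L1_locD[OF g ID(6)[OF b]] .
    have int_g: "integral {a..t} g = RL_integral_raw a 1 g t" if "t \<le> b" for t
      using RL_integral_raw_1[OF ab(2) that] by simp
    show ?thesis
    proof (cases "\<alpha> = 1")
      case True
      \<comment> \<open>For \<alpha> = 1 the two equations coincide except at t = a, where
        \<open>frac_kernel 1 0\<close> is 0.\<close>
      have "AE t in lborel. t \<noteq> a" by (rule AE_lborel_singleton)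
      then have "AE t in lborel. (t \<in> {a..b} \<longrightarrow> RL_integral_raw a (1 - \<alpha>) q t = c + integral {a..t} g) \<longleftrightarrow>
          (t \<in> {a..b} \<longrightarrow> q t = c * frac_kernel \<alpha> (t - a) + RL_integral_raw a \<alpha> g t)"
        by eventually_elim (use True int_g in \<open>auto simp: frac_kernel_1 RL_integral_raw_def[of a 0]\<close>)
      then show ?thesis by (simp add: AE_lebesgue_on_iff_lborel) (rule eventually_subst, simp)
    next
      case False
      then have \<alpha>1: "\<alpha> < 1" using \<alpha> by simp
      obtain \<phi> where \<phi>: "integrable lborel \<phi>" "\<And>s. s \<notin> {a..b} \<Longrightarrow> \<phi> s = 0"
        "AE s in lebesgue. s \<in> {a..b} \<longrightarrow> q s = \<phi> s"
        using absolutely_integrable_borel_representative[OF ab(1)] by blast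
      obtain \<gamma> where \<gamma>: "integrable lborel \<gamma>" "\<And>s. s \<notin> {a..b} \<Longrightarrow> \<gamma> s = 0"
        "AE s in lebesgue. s \<in> {a..b} \<longrightarrow> g s = \<gamma> s"
        using absolutely_integrable_borel_representative[OF ab(2)] by blast
      have m: "\<phi> \<in> borel_measurable borel" "\<gamma> \<in> borel_measurable borel"
        using borel_measurable_integrable[OF \<phi>(1)] borel_measurable_integrable[OF \<gamma>(1)] by simp_all
      have raw_q: "RL_integral_raw a \<beta> q t = frac_conv \<beta> \<phi> t" if "t \<le> b" "\<beta> \<noteq> 0" for \<beta> t
        by (rule RL_integral_raw_eq_frac_conv(1)[OF ab(1) m(1) _ \<phi>(3)]) (use \<phi>(2) that in auto)
      have raw_g: "RL_integral_raw a \<beta> g t = frac_conv \<beta> \<gamma> t" if "t \<le> b" "\<beta> \<noteq> 0" for \<beta> t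
        by (rule RL_integral_raw_eq_frac_conv(1)[OF ab(2) m(2) _ \<gamma>(3)]) (use \<gamma>(2) that in auto)
      have "(AE t in lebesgue_on {a..b}. RL_integral_raw a (1 - \<alpha>) q t = c + integral {a..t} g) \<longleftrightarrow>
        (AE t in lborel. t \<in> {a..b} \<longrightarrow> frac_conv (1 - \<alpha>) \<phi> t = c + frac_conv 1 \<gamma> t)"
        unfolding AE_lebesgue_on_iff_lborel[OF lebesgue_Icc]
        using \<alpha>1 by (intro AE_cong imp_cong) (simp_all add: int_g raw_q raw_g)
      also have "\<dots> \<longleftrightarrow> (AE t in lborel. t \<in> {a..b} \<longrightarrow> \<phi> t = c * frac_kernel \<alpha> (t - a) + frac_conv \<alpha> \<gamma> t)"
        by (rule frac_conv_inversion) (use \<alpha> \<alpha>1 \<phi> \<gamma> in auto)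
      also have "\<dots> \<longleftrightarrow> (AE t in lborel. t \<in> {a..b} \<longrightarrow> q t = c * frac_kernel \<alpha> (t - a) + RL_integral_raw a \<alpha> g t)"
      proof (rule eventually_subst)
        have "AE t in lborel. t \<in> {a..b} \<longrightarrow> q t = \<phi> t" using \<phi>(3) by (simp add: AE_completion_iff)
        then show "AE t in lborel. (t \<in> {a..b} \<longrightarrow> \<phi> t = c * frac_kernel \<alpha> (t - a) + frac_conv \<alpha> \<gamma> t) =
           (t \<in> {a..b} \<longrightarrow> q t = c * frac_kernel \<alpha> (t - a) + RL_integral_raw a \<alpha> g t)"
          by eventually_elim (use \<alpha> raw_g in auto)
      qed
      finally show ?thesis unfolding AE_lebesgue_on_iff_lborel[OF lebesgue_Icc] .
    qed
  qed
  then show ?thesis unfolding AE_left_interval_iff[OF I] by blast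
qed

text \<open>The integral of order \<alpha> of the constant is \<open>c\<close> times the kernel of
  order \<alpha> + 1, the primitive of \<open>c\<close> times the kernel of order \<alpha>;
  \<open>cont_rep_primitive_iff\<close> with initial value 0 differentiates it.\<close>

lemma RL_deriv_const:
  assumes I: "I \<in> left_intervals a" and \<alpha>: "0 < \<alpha>"
  shows "AE t in lebesgue_on I. RL_deriv a I (1 - \<alpha>) (\<lambda>_. c) t = c * frac_kernel \<alpha> (t - a)"
proof -
  note ID = left_intervalsD[OF I]
  let ?g = "\<lambda>t. c * frac_kernel \<alpha> (t - a)"
  have int: "integrable lborel (\<lambda>\<tau>. frac_kernel 1 (t - \<tau>) * ?g \<tau>)"
    "(LINT \<tau>|lborel. frac_kernel 1 (t - \<tau>) * ?g \<tau>) = c * frac_kernel (\<alpha> + 1) (t - a)" for t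
    using frac_kernel_convolution[of 1 \<alpha> t a] \<alpha> by (simp_all add: mult.left_commute add.commute)
  have hi: "(?g has_integral c * frac_kernel (\<alpha> + 1) (t - a)) {a..t}" for t
    using has_integral_frac_kernel_1[OF int(1), of a t] int(2) by simp
  have g: "?g \<in> L1_loc I"
    unfolding L1_loc_def
  proof (intro CollectI allI impI)
    fix x y assume xy: "{x..y} \<subseteq> I"
    have "(\<lambda>t. frac_kernel \<alpha> (t - a)) absolutely_integrable_on {a..y}"
    proof (rule nonnegative_absolutely_integrable_1)
      show "(\<lambda>t. frac_kernel \<alpha> (t - a)) integrable_on {a..y}"
        using has_integral_frac_kernel_1[of y "\<lambda>t. frac_kernel \<alpha> (t - a)" a]
          frac_kernel_convolution(1)[of 1 \<alpha> y a] \<alpha> by (auto dest: has_integral_integrable)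
    qed (use \<alpha> frac_kernel_nonneg in auto)
    then have "?g absolutely_integrable_on {a..y}" by (intro set_integrable_mult_right)
    moreover have "{x..y} \<subseteq> {a..y}" using xy ID(3) by auto
    ultimately show "?g absolutely_integrable_on {x..y}" by (rule absolutely_integrable_on_subinterval)
  qed
  have raw: "RL_integral_raw a \<alpha> (\<lambda>_. c) t = 0 + integral {a..t} ?g" if "t \<in> I" for t
  proof -
    let ?\<phi> = "\<lambda>s. indicator {a..t} s * c"
    have "RL_integral_raw a \<alpha> (\<lambda>_. c) t = frac_conv \<alpha> ?\<phi> t"
      by (rule RL_integral_raw_eq_frac_conv(1)[where b=t])
        (use \<alpha> in \<open>auto intro!: absolutely_integrable_continuous_real continuous_intros AE_I2\<close>)
    also have "\<dots> = (LINT \<tau>|lborel. c * (frac_kernel \<alpha> (t - \<tau>) * frac_kernel 1 (\<tau> - a)))"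
      unfolding frac_conv_def
    proof (rule integral_cong_AE)
      have "AE \<tau> in lborel. \<tau> \<noteq> a" by (rule AE_lborel_singleton)
      then show "AE \<tau> in lborel. frac_kernel \<alpha> (t - \<tau>) * ?\<phi> \<tau> = c * (frac_kernel \<alpha> (t - \<tau>) * frac_kernel 1 (\<tau> - a))"
        by eventually_elim (auto simp: frac_kernel_1 indicator_def)
    qed auto
    also have "\<dots> = c * frac_kernel (\<alpha> + 1) (t - a)"
      using frac_kernel_convolution(2)[of \<alpha> 1 t a] \<alpha> by simp
    finally show ?thesis unfolding integral_unique[OF hi] by simp
  qed
  then have "AE t in lebesgue_on I. RL_integral_raw a \<alpha> (\<lambda>_. c) t = 0 + integral {a..t} ?g" by (auto intro!: AE_I2)
  then have "AE t in lebesgue_on I. deriv (cont_rep I (RL_integral_raw a \<alpha> (\<lambda>_. c))) t = ?g t"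
    using cont_rep_primitive_iff[OF I g] by blast
  moreover have "RL_deriv a I (1 - \<alpha>) (\<lambda>_. c) t = deriv (cont_rep I (RL_integral_raw a \<alpha> (\<lambda>_. c))) t" for t
    by (simp add: RL_deriv_def RL_integral_def)
  ultimately show ?thesis by simp
qed

text \<open>Needed to read the vector integral componentwise: it is 0 by convention as soon as one
  component fails to be integrable. The source is the last claim of
  \<open>frac_conv_semigroup\<close> with outer order 1.\<close>

lemma AE_set_integrable_RL_kernel:
  fixes g :: "real \<Rightarrow> real"
  assumes I: "I \<in> left_intervals a" and \<alpha>: "0 < \<alpha>" and g: "g \<in> L1_loc I"
  shows "AE t in lebesgue_on I.
    set_integrable lebesgue {a..t} (\<lambda>\<tau>. (1 / Gamma \<alpha> * (t - \<tau>) powr (\<alpha> - 1)) * g \<tau>)"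
  unfolding AE_left_interval_iff[OF I]
proof (intro ballI impI)
  fix b assume b: "b \<in> I"
  have ab: "g absolutely_integrable_on {a..b}" by (rule L1_locD[OF g left_intervalsD(6)[OF I b]])
  obtain \<gamma> where \<gamma>: "integrable lborel \<gamma>" "\<And>s. s \<notin> {a..b} \<Longrightarrow> \<gamma> s = 0"
    "AE s in lebesgue. s \<in> {a..b} \<longrightarrow> g s = \<gamma> s"
    using absolutely_integrable_borel_representative[OF ab] by blast
  have m: "\<gamma> \<in> borel_measurable borel" using borel_measurable_integrable[OF \<gamma>(1)] by simp
  have "AE \<tau> in lborel. \<tau> < b \<longrightarrow> integrable lborel (\<lambda>s. frac_kernel \<alpha> (\<tau> - s) * \<gamma> s)"
    using frac_conv_semigroup(3)[of 1 \<alpha> \<gamma> a b] \<alpha> \<gamma> by auto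
  moreover have "AE \<tau> in lborel. \<tau> \<noteq> b" by (rule AE_lborel_singleton)
  ultimately have "AE t in lborel. t \<in> {a..b} \<longrightarrow>
    set_integrable lebesgue {a..t} (\<lambda>\<tau>. (1 / Gamma \<alpha> * (t - \<tau>) powr (\<alpha> - 1)) * g \<tau>)"
    by eventually_elim (use RL_integral_raw_eq_frac_conv(2)[OF ab m \<gamma>(2,3)] in auto)
  then show "AE t in lebesgue_on {a..b}.
    set_integrable lebesgue {a..t} (\<lambda>\<tau>. (1 / Gamma \<alpha> * (t - \<tau>) powr (\<alpha> - 1)) * g \<tau>)"
    by (simp add: AE_lebesgue_on_iff_lborel)
qed

text \<open>\<open>cont_rep_primitive_iff\<close>, applied to the integral of order 1 - \<alpha> of
  \<open>q\<close>, removes derivative and initial value; \<open>RL_integral_raw_Abel_iff\<close>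
  then solves for \<open>q\<close>.\<close>

lemma RL_solution_scalar_iff:
  assumes I: "I \<in> left_intervals a" and \<alpha>: "0 < \<alpha>" "\<alpha> \<le> 1" and g: "g \<in> L1_loc I"
  shows "(q \<in> AC_frac a I \<alpha> \<and> RL_integral a I (1 - \<alpha>) q a = c \<and>
      (AE t in lebesgue_on I. RL_deriv a I \<alpha> q t = g t)) \<longleftrightarrow>
    q \<in> L1_loc I \<and>
      (AE t in lebesgue_on I. q t = RL_deriv a I (1 - \<alpha>) (\<lambda>_. c) t + RL_integral a I \<alpha> g t)"
proof -
  have "(AE t in lebesgue_on I. q t = RL_deriv a I (1 - \<alpha>) (\<lambda>_. c) t + RL_integral a I \<alpha> g t) \<longleftrightarrow>
    (AE t in lebesgue_on I. q t = c * frac_kernel \<alpha> (t - a) + RL_integral_raw a \<alpha> g t)"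
  proof (rule eventually_subst)
    show "AE t in lebesgue_on I. (q t = RL_deriv a I (1 - \<alpha>) (\<lambda>_. c) t + RL_integral a I \<alpha> g t) =
      (q t = c * frac_kernel \<alpha> (t - a) + RL_integral_raw a \<alpha> g t)"
      unfolding RL_integral_def
      using RL_deriv_const[OF I \<alpha>(1), of c] cont_rep_AE[of I "RL_integral_raw a \<alpha> g"] by eventually_elim simp
  qed
  then show ?thesis
    unfolding AC_frac_def RL_deriv_def[of _ _ \<alpha>] RL_integral_def[of _ _ "1 - \<alpha>"] mem_Collect_eq
    using cont_rep_primitive_iff[OF I g, of "RL_integral_raw a (1 - \<alpha>) q" c]
      RL_integral_raw_Abel_iff[OF I \<alpha> _ g, of q c] by blast
qed

section \<open>From scalar components to vector functions\<close>

lemma absolutely_integrable_vec_iff: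
  fixes f :: "'a::euclidean_space \<Rightarrow> real^'m"
  shows "f absolutely_integrable_on S \<longleftrightarrow> (\<forall>i. (\<lambda>x. f x $ i) absolutely_integrable_on S)"
  by (auto simp: absolutely_integrable_componentwise_iff[where f=f] Basis_vec_def cart_eq_inner_axis)

lemma L1_loc_vec_iff:
  fixes q :: "real \<Rightarrow> real^'m"
  shows "q \<in> L1_loc I \<longleftrightarrow> (\<forall>i. (\<lambda>t. q t $ i) \<in> L1_loc I)"
  by (auto simp: L1_loc_def absolutely_integrable_vec_iff)

lemma AE_vec_eq_iff:
  fixes u v :: "'a \<Rightarrow> real^'m"
  shows "(AE t in M. u t = v t) \<longleftrightarrow> (\<forall>i. AE t in M. u t $ i = v t $ i)"
  by (simp add: vec_eq_iff AE_all_countable)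

theorem proposition6:
  fixes a :: real
    and I :: "real set"
    and f :: "(real^'m) \<Rightarrow> real \<Rightarrow> (real^'m)"
    and q\<^sub>a \<alpha> :: "real^'m"
    and q :: "real \<Rightarrow> real^'m"
  assumes "I \<in> left_intervals a"
    and "caratheodory I f"
    and "\<forall>i. 0 < \<alpha> $ i \<and> \<alpha> $ i \<le> 1"
    and "\<forall>p \<in> L1_loc I. (\<lambda>t. f (p t) t) \<in> L1_loc I"
  shows "(RL_solution a I f \<alpha> q\<^sub>a q \<longleftrightarrow>
            q \<in> L1_loc I \<and>
            (AE t in lebesgue_on I.
               q t = RL_deriv_vec a I (1 - \<alpha>) (\<lambda>_. q\<^sub>a) t
                     + RL_integral_vec a I \<alpha> (\<lambda>s. f (q s) s) t)) \<and>
         (q \<in> L1_loc I \<longrightarrow>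
            (AE t in lebesgue_on I.
               RL_deriv_vec a I (1 - \<alpha>) (\<lambda>_. q\<^sub>a) t
                 + RL_integral_vec a I \<alpha> (\<lambda>s. f (q s) s) t
               = RL_kernel \<alpha> (t - a) * q\<^sub>a
                 + (LINT \<tau>:{a..t}|lebesgue. RL_kernel \<alpha> (t - \<tau>) * f (q \<tau>) \<tau>)))"
proof (cases "q \<in> L1_loc I")
  case False
  then have "\<not> RL_solution a I f \<alpha> q\<^sub>a q"
    unfolding RL_solution_def AC_frac_vec_def AC_frac_def L1_loc_vec_iff by auto
  then show ?thesis using False by blast
next
  case True
  note I = assms(1)
  define g where "g i t = f (q t) t $ i" for i t
  have g: "g i \<in> L1_loc I" for i
    using assms(4) True unfolding g_def by (metis L1_loc_vec_iff)
  have q: "(\<lambda>t. q t $ i) \<in> L1_loc I" for i using True unfolding L1_loc_vec_iff by blast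
  have \<alpha>: "0 < \<alpha> $ i" "\<alpha> $ i \<le> 1" for i using assms(3) by auto
  have "RL_solution a I f \<alpha> q\<^sub>a q \<longleftrightarrow> (\<forall>i. (\<lambda>t. q t $ i) \<in> AC_frac a I (\<alpha> $ i) \<and>
     RL_integral a I (1 - \<alpha> $ i) (\<lambda>t. q t $ i) a = q\<^sub>a $ i \<and>
     (AE t in lebesgue_on I. RL_deriv a I (\<alpha> $ i) (\<lambda>t. q t $ i) t = g i t))"
    unfolding RL_solution_def AE_vec_eq_iff
    by (auto simp: AC_frac_vec_def RL_integral_vec_def RL_deriv_vec_def g_def vec_eq_iff)
  also have "\<dots> \<longleftrightarrow> (\<forall>i. AE t in lebesgue_on I. q t $ i =
     RL_deriv a I (1 - \<alpha> $ i) (\<lambda>_. q\<^sub>a $ i) t + RL_integral a I (\<alpha> $ i) (g i) t)"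
    using q by (simp add: RL_solution_scalar_iff[OF I \<alpha> g])
  also have "\<dots> \<longleftrightarrow> (AE t in lebesgue_on I. q t = RL_deriv_vec a I (1 - \<alpha>) (\<lambda>_. q\<^sub>a) t
                     + RL_integral_vec a I \<alpha> (\<lambda>s. f (q s) s) t)"
    unfolding AE_vec_eq_iff by (simp add: RL_integral_vec_def RL_deriv_vec_def g_def[abs_def])
  finally have 1: "RL_solution a I f \<alpha> q\<^sub>a q \<longleftrightarrow> (AE t in lebesgue_on I. q t = RL_deriv_vec a I (1 - \<alpha>) (\<lambda>_. q\<^sub>a) t
                     + RL_integral_vec a I \<alpha> (\<lambda>s. f (q s) s) t)" .
  let ?k = "\<lambda>t \<tau>. RL_kernel \<alpha> (t - \<tau>) * f (q \<tau>) \<tau>"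
  have "AE t in lebesgue_on I. \<forall>i. set_integrable lebesgue {a..t} (\<lambda>\<tau>. ?k t \<tau> $ i)"
    unfolding AE_all_countable
    using AE_set_integrable_RL_kernel[OF I \<alpha>(1) g] by (simp add: RL_kernel_def g_def)
  then have int: "AE t in lebesgue_on I. set_integrable lebesgue {a..t} (?k t)"
    by (simp add: absolutely_integrable_vec_iff)
  have "AE t in lebesgue_on I. (RL_deriv_vec a I (1 - \<alpha>) (\<lambda>_. q\<^sub>a) t
                 + RL_integral_vec a I \<alpha> (\<lambda>s. f (q s) s) t) $ i
               = (RL_kernel \<alpha> (t - a) * q\<^sub>a + (LINT \<tau>:{a..t}|lebesgue. ?k t \<tau>)) $ i" for i
    using AE_left_interval_neq[OF I] RL_deriv_const[OF I \<alpha>(1)[of i], of "q\<^sub>a $ i"] int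
      cont_rep_AE[of I "RL_integral_raw a (\<alpha> $ i) (g i)"]
  proof eventually_elim
    case (elim t)
    \<comment> \<open>Taking a component commutes with the integral because the vector integrand is
      integrable for this \<open>t\<close>.\<close>
    have "(LINT \<tau>:{a..t}|lebesgue. ?k t \<tau>) $ i = (LINT \<tau>:{a..t}|lebesgue. ?k t \<tau> $ i)"
      using integral_bounded_linear[OF bounded_linear_vec_nth elim(3)[unfolded set_integrable_def], of i]
      by (simp add: set_lebesgue_integral_def)
    also have "\<dots> = RL_integral_raw a (\<alpha> $ i) (g i) t"
      using \<alpha>(1)[of i] by (simp add: RL_integral_raw_def RL_kernel_def g_def)
    finally show ?case
      using elim(1,2,4)
      by (simp add: RL_deriv_vec_def RL_integral_vec_def RL_integral_def RL_kernel_def frac_kernel_def g_def[abs_def])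
  qed
  then show ?thesis using 1 True unfolding AE_vec_eq_iff by blast
qed

end
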